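(* Assume (A1), (A2), (A3) (see context). Suppose there exist a locally bounded measurable function $\phi:\mathbb R_+\to\mathbb R_+$ and constants $C_0>0$, $\zeta\ge0$ such that $\phi(r)\le C_0r^{-2+\zeta}$ for $r\ge1$, and for $\mathcal P_0$-a.a. $\omega$, $$\mathrm E_0[c_{0,x}(\omega)\mid\hat\omega]\le\phi(|x|)\qquad\text{for all }x\in\hat\omega\text{ with }x\sim0 .$$ Then $\lambda_0,\lambda_2\in L^1(\mathcal P_0)$ provided at least one of the following holds: (H1) $\rho_\gamma<+\infty$ for some $\gamma>2$, and Condition $C(\alpha)$ holds for some $\alpha>\frac{\gamma}{\gamma-2}(d+\zeta)$; (H2) $\rho_2<+\infty$ and $\mathbb P$ has finite range of dependence; (H3) $\rho_2<+\infty$, $\mathbb P$ has positive association, and Condition $C(\alpha)$ holds for some $\alpha>d+\zeta$.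
   Context: Notation: $|\cdot|$ is the Euclidean norm on $\mathbb R^d$, $\Lambda_r=[-r,r]^d$. $\mathcal N$ is the set of locally finite subsets of $\mathbb R^d$; $\xi\in\mathcal N$ is identified with the counting measure $\sum_{x\in\xi}\delta_x$, so $\xi(A)=\#(\xi\cap A)$; $\mathcal N$ carries the $\sigma$-algebra generated by $\xi\mapsto\xi(A)$, $A$ Borel. Translations: $\tau_x\xi:=\xi-x$. Voronoi cell: $\mathrm{Vor}(x|\xi)=\{y:|y-x|\le|y-z|\ \forall z\in\xi\}$ for $x\in\xi$. The Delaunay triangulation $\mathrm{DT}(\xi)$ is the graph on $\xi$ whose edges are the pairs $\{x,y\}$, $x\ne y$, with $\mathrm{Vor}(x|\xi)$, $\mathrm{Vor}(y|\xi)$ sharing a $(d-1)$-dimensional face; write $x\sim y$. Setting: $(\Omega,\mathcal F,\mathcal P)$ probability space (expectation $\mathrm E$) with a measurable action $(\theta_x)_{x\in\mathbb R^d}$ of $\mathbb R^d$; $\omega\mapsto\hat\omega\in\mathcal N$ a simple point process with law $\mathbb P$ (expectation $\mathbb E$); $c_{x,y}(\omega)\ge0$ a measurable symmetric conductance field with $c_{x,x}=0$ and $c_{x,y}(\omega)=0$ unless $\{x,y\}$ is an edge of $\mathrm{DT}(\hat\omega)$. (A1) $\mathcal P$ is invariant under all $\theta_x$ and $\mathcal P(\hat\omega=\emptyset)=0$; (A2) $m:=\mathbb E[\xi([0,1]^d)]\in(0,\infty)$; (A3) there is a measurable $\theta$-invariant $\Omega_*$ of full measure such that for $\omega\in\Omega_*$: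 $\widehat{\theta_x\omega}=\tau_x\hat\omega$ for all $x$ and $c_{y-x,z-x}(\theta_x\omega)=c_{y,z}(\omega)$ for all $x$ and all edges $\{y,z\}$ of $\mathrm{DT}(\hat\omega)$. Palm distribution: $\mathcal P_0(A)=\frac1m\int d\mathcal P(\omega)\sum_{x\in\hat\omega\cap[0,1]^d}\mathbf 1_A(\theta_x\omega)$, concentrated on $\Omega_0=\{\omega:0\in\hat\omega\}$, expectation $\mathrm E_0$. For $\omega\in\Omega_0$ and $k=0,2$: $\lambda_k(\omega):=\sum_{x\in\hat\omega:x\sim0}c_{0,x}(\omega)|x|^k$. $\rho_\gamma:=\mathbb E[\xi([0,1]^d)^\gamma]$. Condition $C(\alpha)$: there is $\kappa>0$ with $\mathbb P(\xi(\Lambda_\ell)=0)\le\kappa\ell^{-\alpha}$ for all $\ell\ge1$. Finite range of dependence: there is $L>0$ such that for Borel $A,B$ at distance $\ge L$, $\xi\cap A$ and $\xi\cap B$ are independent under $\mathbb P$. Positive association: for weakly increasing $f,g$ and pairwise disjoint bounded Borel sets $A_1,\dots,A_n,B_1,\dots,B_k$, $\mathrm{Cov}_{\mathbb P}(f(\xi(A_1),\dots,\xi(A_n)),g(\xi(B_1),\dots,\xi(B_k)))\ge0$ whenever both have finite second moments. *)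

theory Defs
  imports "HOL-Probability.Probability"
begin

definition loc_fin :: "'a::euclidean_space set set" where
  "loc_fin = {\<xi>. \<forall>B. bounded B \<longrightarrow> finite (\<xi> \<inter> B)}"

definition pcount :: "'a set \<Rightarrow> 'a set \<Rightarrow> ennreal" where
  "pcount \<xi> A = emeasure (count_space UNIV) (\<xi> \<inter> A)"

definition N_space :: "'a::euclidean_space set measure" where
  "N_space = sigma loc_fin
     {{\<xi> \<in> loc_fin. pcount \<xi> A \<in> S} | A S. A \<in> sets borel \<and> S \<in> sets (borel :: ennreal measure)}"

definition Lambda :: "real \<Rightarrow> 'a::euclidean_space set" where
  "Lambda r = cbox (- (r *\<^sub>R One)) (r *\<^sub>R One)"

definition unit_cube :: "'a::euclidean_space set" where
  "unit_cube = cbox 0 One"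

definition Vor :: "'a::euclidean_space \<Rightarrow> 'a set \<Rightarrow> 'a set" where
  "Vor x \<xi> = {y. \<forall>z\<in>\<xi>. norm (y - x) \<le> norm (y - z)}"

definition DT_edge :: "'a::euclidean_space set \<Rightarrow> 'a \<Rightarrow> 'a \<Rightarrow> bool" where
  "DT_edge \<xi> x y \<longleftrightarrow> x \<in> \<xi> \<and> y \<in> \<xi> \<and> x \<noteq> y \<and>
     (\<exists>F. F face_of Vor x \<xi> \<and> F face_of Vor y \<xi> \<and> aff_dim F = int DIM('a) - 1)"

definition intensity :: "'w measure \<Rightarrow> ('w \<Rightarrow> 'a::euclidean_space set) \<Rightarrow> ennreal" where
  "intensity M pp = (\<integral>\<^sup>+ \<omega>. pcount (pp \<omega>) unit_cube \<partial>M)"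

definition Palm :: "'w measure \<Rightarrow> ('a::euclidean_space \<Rightarrow> 'w \<Rightarrow> 'w) \<Rightarrow> ('w \<Rightarrow> 'a set) \<Rightarrow> 'w measure" where
  "Palm M \<theta> pp = measure_of (space M) (sets M)
     (\<lambda>A. (\<integral>\<^sup>+ \<omega>. (\<integral>\<^sup>+ x. indicator A (\<theta> x \<omega>) \<partial>count_space (pp \<omega> \<inter> unit_cube)) \<partial>M)
          / intensity M pp)"

definition lam :: "('w \<Rightarrow> 'a::euclidean_space \<Rightarrow> 'a \<Rightarrow> real) \<Rightarrow> ('w \<Rightarrow> 'a set) \<Rightarrow> nat \<Rightarrow> 'w \<Rightarrow> ennreal" where
  "lam c pp k \<omega> = (\<integral>\<^sup>+ x. ennreal (c \<omega> 0 x * norm x ^ k) \<partial>count_space {x. DT_edge (pp \<omega>) 0 x})"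

definition epow :: "ennreal \<Rightarrow> real \<Rightarrow> ennreal" where
  "epow t \<gamma> = (if t = \<infinity> then \<infinity> else ennreal (enn2real t powr \<gamma>))"

definition rho :: "'w measure \<Rightarrow> ('w \<Rightarrow> 'a::euclidean_space set) \<Rightarrow> real \<Rightarrow> ennreal" where
  "rho M pp \<gamma> = (\<integral>\<^sup>+ \<omega>. epow (pcount (pp \<omega>) unit_cube) \<gamma> \<partial>M)"

definition condC :: "'a::euclidean_space set measure \<Rightarrow> real \<Rightarrow> bool" where
  "condC Q \<alpha> \<longleftrightarrow> (\<exists>\<kappa>>0. \<forall>l\<ge>1.
      measure Q {\<xi> \<in> space Q. pcount \<xi> (Lambda l) = 0} \<le> \<kappa> * l powr (- \<alpha>))"

definition finite_range :: "'a::euclidean_space set measure \<Rightarrow> bool" where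
  "finite_range Q \<longleftrightarrow> (\<exists>L>0. \<forall>A B. A \<in> sets borel \<longrightarrow> B \<in> sets borel \<longrightarrow> setdist A B \<ge> L \<longrightarrow>
      prob_space.indep_var Q N_space (\<lambda>\<xi>. \<xi> \<inter> A) N_space (\<lambda>\<xi>. \<xi> \<inter> B))"

definition pos_assoc :: "'a::euclidean_space set measure \<Rightarrow> bool" where
  "pos_assoc Q \<longleftrightarrow> (\<forall>(As :: 'a set list) (Bs :: 'a set list) (f :: nat list \<Rightarrow> real) (g :: nat list \<Rightarrow> real).
      (\<forall>A \<in> set (As @ Bs). A \<in> sets borel \<and> bounded A) \<longrightarrow>
      (\<forall>i < length (As @ Bs). \<forall>j < length (As @ Bs). i \<noteq> j \<longrightarrow> (As @ Bs) ! i \<inter> (As @ Bs) ! j = {}) \<longrightarrow>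
      (\<forall>u v. length u = length As \<longrightarrow> list_all2 (\<le>) u v \<longrightarrow> f u \<le> f v) \<longrightarrow>
      (\<forall>u v. length u = length Bs \<longrightarrow> list_all2 (\<le>) u v \<longrightarrow> g u \<le> g v) \<longrightarrow>
      (let F = (\<lambda>\<xi>. f (map (\<lambda>A. card (\<xi> \<inter> A)) As));
           G = (\<lambda>\<xi>. g (map (\<lambda>B. card (\<xi> \<inter> B)) Bs)) in
       integrable Q (\<lambda>\<xi>. (F \<xi>)\<^sup>2) \<longrightarrow> integrable Q (\<lambda>\<xi>. (G \<xi>)\<^sup>2) \<longrightarrow>
       (\<integral>\<xi>. F \<xi> * G \<xi> \<partial>Q) - (\<integral>\<xi>. F \<xi> \<partial>Q) * (\<integral>\<xi>. G \<xi> \<partial>Q) \<ge> 0))"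

end

(* The conductances vanish off the Delaunay edges, so E_0[lambda_k] is an expectation of a sum over all
   points x of the process, and conditioning on the process replaces c_{0,x} by phi(|x|).
   If x ~ 0 and |x| is of order 2^n, some ball with 0 on its boundary and diameter at least |x| contains
   no point. That ball contains one of boundedly many (independently of n) grid boxes Q of side of order
   2^n, centred within distance of order 2^n of 0. Through the Palm formula,
   E_0[lambda_k] is bounded by a dyadic sum of terms 2^(n zeta) E[xi(U_i) xi(U_j); xi(Q) = 0] over about
   2^(n d) unit cells U_j, and by xy <= x^2 + y^2 everything reduces to
     E[xi(U)^2; xi(Q) = 0] <= K l^(-beta) for some beta > d + zeta, where Q has half-side l.
   (H1): split according to whether xi(U) exceeds l^(alpha/gamma), which gives
   beta = alpha (gamma - 2) / gamma.
   (H2): Q contains about l/s separated translates of a box that is void with probability at most 1/2,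
   at most one of them close to U, so the decay is exponential.
   (H3): cells and boxes lie on the integer grid, so U is contained in Q, or disjoint from it; in the
   latter case xi(U)^2 is increasing and the void indicator of Q decreasing, so they are negatively correlated
   (after truncation), and beta = alpha. *)

theory Submission
  imports Defs "HOL-Real_Asymp.Real_Asymp"
begin

section \<open>Point counts\<close>

text \<open>The conductances are bounded only along Delaunay edges and only after conditioning on
  the process, and the conditioning can be tested only against measurable functions of a
  configuration and a point. So the edge relation is enlarged to a visibly measurable set of pairs:
  the point is close to 0, or it lies in a dyadic shell one of whose grid boxes is void. Nothing
  changes on the side of \<open>c\<close>, which vanishes off the edges, and the enlarged set is
  exactly what the estimate can sum over.

  The centre of an empty ball may be arbitrarily far away. Shrinking the ball towards 0, to a radius
  tied to the shell of x, is what leaves boundedly many candidate boxes per scale.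

  The Palm formula recentres at a point anywhere in the unit cube, so each void box seen from that
  point is taken one unit larger than the fixed box whose void event is finally estimated.

  The threshold d + zeta is the balance of three powers: |x|^2 phi(|x|) <= C0 |x|^zeta gives 2^(n
  zeta), the number of cells gives 2^(n d), the void moment gives 2^(-n beta). The series is then
  geometric with ratio below 1.\<close>

lemma space_N_space: "space (N_space :: 'a::euclidean_space set measure) = loc_fin"
  unfolding N_space_def by (rule space_measure_of) auto

lemma measurable_pcount [measurable]:
  assumes "A \<in> sets borel"
  shows "(\<lambda>\<xi>. pcount \<xi> A) \<in> borel_measurable (N_space :: 'a::euclidean_space set measure)"
proof (rule measurableI)
  fix S :: "ennreal set" assume "S \<in> sets borel"
  with assms have "{\<xi> \<in> loc_fin. pcount \<xi> A \<in> S} \<in> sets (N_space :: 'a set measure)"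
    unfolding N_space_def by (intro in_measure_of) auto
  also have "{\<xi> \<in> loc_fin. pcount \<xi> A \<in> S} = (\<lambda>\<xi>. pcount \<xi> A) -` S \<inter> space N_space"
    by (auto simp: space_N_space)
  finally show "(\<lambda>\<xi>. pcount \<xi> A) -` S \<inter> space N_space \<in> sets N_space" .
qed simp

lemma pcount_eq_0_iff: "pcount \<xi> A = 0 \<longleftrightarrow> \<xi> \<inter> A = {}"
  unfolding pcount_def by (subst emeasure_count_space_eq_0) auto

lemma pcount_mono: "A \<subseteq> B \<Longrightarrow> pcount \<xi> A \<le> pcount \<xi> B"
  unfolding pcount_def by (intro emeasure_mono) auto

lemma pcount_eq_card:
  assumes "\<xi> \<in> loc_fin" "bounded A"
  shows "pcount \<xi> A = of_nat (card (\<xi> \<inter> A))"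
  using assms unfolding pcount_def loc_fin_def by (simp add: emeasure_count_space_finite)

lemma pcount_le_sum:
  assumes "finite J" "A \<subseteq> (\<Union>j\<in>J. U j)"
  shows "pcount \<xi> A \<le> (\<Sum>j\<in>J. pcount \<xi> (U j))"
proof -
  have "pcount \<xi> A \<le> emeasure (count_space UNIV) (\<Union>j\<in>J. \<xi> \<inter> U j)"
    unfolding pcount_def using assms by (intro emeasure_mono) auto
  also have "\<dots> \<le> (\<Sum>j\<in>J. pcount \<xi> (U j))"
    unfolding pcount_def using assms by (intro emeasure_subadditive_finite) auto
  finally show ?thesis .
qed

lemma pcount_translate: "pcount ((\<lambda>y. y - x) ` \<xi>) A = pcount \<xi> ((\<lambda>y. y + x) ` A)"
  for x :: "'a::euclidean_space"
proof -
  have *: "(\<lambda>y. y - x) ` (\<xi> \<inter> (\<lambda>y. y + x) ` A) = (\<lambda>y. y - x) ` \<xi> \<inter> A"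
    by force
  have "inj_on (\<lambda>y. y - x) (\<xi> \<inter> (\<lambda>y. y + x) ` A)" by (auto simp: inj_on_def)
  then have "bij_betw (\<lambda>y. y - x) (\<xi> \<inter> (\<lambda>y. y + x) ` A) ((\<lambda>y. y - x) ` \<xi> \<inter> A)"
    using * by (simp add: bij_betw_def)
  then show ?thesis
    unfolding pcount_def using bij_betw_finite[of "\<lambda>y. y - x"] bij_betw_same_card[of "\<lambda>y. y - x"]
    by (auto simp: emeasure_count_space)
qed

lemma nn_integral_count_indicator: "(\<integral>\<^sup>+x. indicator A x \<partial>count_space \<xi>) = pcount \<xi> A"
proof -
  have "(\<integral>\<^sup>+x. indicator A x \<partial>count_space \<xi>) = (\<integral>\<^sup>+x. indicator (A \<inter> \<xi>) x \<partial>count_space \<xi>)"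
    by (intro nn_integral_cong) (auto simp: indicator_def)
  also have "\<dots> = emeasure (count_space \<xi>) (A \<inter> \<xi>)"
    by (intro nn_integral_indicator) auto
  finally show ?thesis
    unfolding pcount_def by (simp add: emeasure_count_space Int_commute)
qed

text \<open>The measure \<open>count_space (pp \<omega>)\<close> varies with \<omega>, so
  measurability comes from a Dynkin argument: on a rectangle the sum is an indicator times a count.
  Cutting down to the bounded set \<open>B\<close> keeps the counts finite, so that the complement
  step may subtract in \<open>ennreal\<close>.\<close>

lemma measurable_count_sum_bounded:
  fixes B :: "'a::euclidean_space set"
  assumes pp: "pp \<in> measurable M N_space"
    and B: "B \<in> sets borel" "bounded B"
    and f: "f \<in> borel_measurable (M \<Otimes>\<^sub>M borel)"
  shows "(\<lambda>\<omega>. \<integral>\<^sup>+x. f (\<omega>, x) * indicator B x \<partial>count_space (pp \<omega>)) \<in> borel_measurable M"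
proof -
  note [measurable] = pp B(1)
  have lf: "pp \<omega> \<in> loc_fin" if "\<omega> \<in> space M" for \<omega>
    using measurable_space[OF pp that] by (simp add: space_N_space)
  have fin: "pcount (pp \<omega>) B < \<infinity>" if "\<omega> \<in> space M" for \<omega>
    using pcount_eq_card[OF lf[OF that] B(2)] by (simp add: ennreal_of_nat_eq_real_of_nat)
  have cnt: "(\<lambda>\<omega>. pcount (pp \<omega>) C) \<in> borel_measurable M" if "C \<in> sets borel" for C
    using that by measurable
  have ind: "(\<lambda>\<omega>. \<integral>\<^sup>+x. indicator A (\<omega>, x) * indicator B x \<partial>count_space (pp \<omega>)) \<in> borel_measurable M"
    if A: "A \<in> sets (M \<Otimes>\<^sub>M borel)" for A
  proof -
    let ?G = "{a \<times> b |a b. a \<in> sets M \<and> b \<in> sets (borel :: 'a measure)}"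
    have sub: "?G \<subseteq> Pow (space M \<times> UNIV)" using sets.sets_into_space by fastforce
    have sig: "A \<in> sigma_sets (space M \<times> UNIV) ?G"
      using A by (simp add: sets_pair_measure)
    from Int_stable_pair_measure_generator sub sig show ?thesis
    proof (induction rule: sigma_sets_induct_disjoint)
      case (basic A)
      then obtain a b where ab: "A = a \<times> b" "a \<in> sets M" "b \<in> sets borel" by auto
      have "(\<integral>\<^sup>+x. indicator A (\<omega>, x) * indicator B x \<partial>count_space (pp \<omega>))
          = indicator a \<omega> * pcount (pp \<omega>) (b \<inter> B)" for \<omega>
        unfolding nn_integral_count_indicator[symmetric] ab
        by (subst nn_integral_cmult[symmetric]) (auto intro!: nn_integral_cong simp: indicator_def)
      moreover have "(\<lambda>\<omega>. indicator a \<omega> * pcount (pp \<omega>) (b \<inter> B)) \<in> borel_measurable M"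
        using ab by (intro borel_measurable_times_ennreal cnt borel_measurable_indicator) auto
      ultimately show ?case by simp
    next
      case empty
      then show ?case by simp
    next
      case (compl A)
      let ?K = "\<lambda>A \<omega>. \<integral>\<^sup>+x. indicator A (\<omega>, x) * indicator B x \<partial>count_space (pp \<omega>)"
      have le: "?K A \<omega> \<le> pcount (pp \<omega>) B" for \<omega>
        unfolding nn_integral_count_indicator[symmetric] by (intro nn_integral_mono) (auto simp: indicator_def)
      have "?K (space M \<times> UNIV - A) \<omega> = pcount (pp \<omega>) B - ?K A \<omega>" if \<omega>: "\<omega> \<in> space M" for \<omega>
      proof -
        have "?K (space M \<times> UNIV - A) \<omega> + ?K A \<omega> = pcount (pp \<omega>) B"
          unfolding nn_integral_count_indicator[symmetric] using \<omega>
          by (subst nn_integral_add[symmetric]) (auto intro!: nn_integral_cong simp: indicator_def)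
        moreover have "?K A \<omega> \<noteq> \<top>" using fin[OF \<omega>] le[of \<omega>] by (auto simp: top_unique)
        ultimately show ?thesis by (metis ennreal_add_diff_cancel_right)
      qed
      moreover have "(\<lambda>\<omega>. pcount (pp \<omega>) B - ?K A \<omega>) \<in> borel_measurable M"
        using compl.IH cnt[OF B(1)] by measurable
      ultimately show ?case by (simp cong: measurable_cong)
    next
      case (union A)
      have *: "indicator (\<Union>i. A i) (\<omega>, x) * indicator B x
         = (\<Sum>i. indicator (A i) (\<omega>, x) * indicator B x :: ennreal)" for \<omega> x
        using suminf_indicator[OF union.hyps(1)] by (simp add: ennreal_suminf_multc)
      have "(\<integral>\<^sup>+x. indicator (\<Union>i. A i) (\<omega>, x) * indicator B x \<partial>count_space (pp \<omega>))
          = (\<Sum>i. \<integral>\<^sup>+x. indicator (A i) (\<omega>, x) * indicator B x \<partial>count_space (pp \<omega>))" for \<omega>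
        unfolding * by (rule nn_integral_suminf) simp
      then show ?case using union.IH by simp
    qed
  qed
  from f show ?thesis
  proof (induction rule: borel_measurable_induct)
    case (cong f g)
    have "(\<integral>\<^sup>+x. g (\<omega>, x) * indicator B x \<partial>count_space (pp \<omega>))
        = (\<integral>\<^sup>+x. f (\<omega>, x) * indicator B x \<partial>count_space (pp \<omega>))" if "\<omega> \<in> space M" for \<omega>
      using cong(3) that by (intro nn_integral_cong) (auto simp: space_pair_measure)
    then show ?case using cong(4) by (simp cong: measurable_cong)
  next
    case (set A)
    then show ?case by (rule ind)
  next
    case (mult u c)
    then show ?case by (simp add: nn_integral_cmult mult.assoc)
  next
    case (add u v)
    then show ?case by (simp add: nn_integral_add distrib_right)
  next
    case (seq U)
    have "(\<integral>\<^sup>+x. (SUP i. U i) (\<omega>, x) * indicator B x \<partial>count_space (pp \<omega>))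
        = (SUP i. \<integral>\<^sup>+x. U i (\<omega>, x) * indicator B x \<partial>count_space (pp \<omega>))" for \<omega>
    proof -
      have "(\<integral>\<^sup>+x. (SUP i. U i (\<omega>, x) * indicator B x) \<partial>count_space (pp \<omega>))
        = (SUP i. \<integral>\<^sup>+x. U i (\<omega>, x) * indicator B x \<partial>count_space (pp \<omega>))"
        using seq(3)
        by (intro nn_integral_monotone_convergence_SUP)
           (auto simp: incseq_def le_fun_def intro!: mult_right_mono)
      then show ?thesis
        by (simp add: SUP_mult_right_ennreal image_comp o_def)
    qed
    then have "(\<lambda>\<omega>. \<integral>\<^sup>+x. (SUP i. U i) (\<omega>, x) * indicator B x \<partial>count_space (pp \<omega>))
        = (\<lambda>\<omega>. SUP i. \<integral>\<^sup>+x. U i (\<omega>, x) * indicator B x \<partial>count_space (pp \<omega>))" by blast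
    moreover have "\<dots> \<in> borel_measurable M"
      using seq by (intro borel_measurable_SUP) auto
    ultimately show ?case using seq.hyps by simp
  qed
qed

text \<open>Balls of radius \<open>n\<close> exhaust the space, and monotone convergence removes the
  bounded window.\<close>

lemma measurable_count_sum:
  fixes pp :: "'w \<Rightarrow> 'a::euclidean_space set"
  assumes pp: "pp \<in> measurable M N_space"
    and f: "f \<in> borel_measurable (M \<Otimes>\<^sub>M borel)"
  shows "(\<lambda>\<omega>. \<integral>\<^sup>+x. f (\<omega>, x) \<partial>count_space (pp \<omega>)) \<in> borel_measurable M"
proof -
  let ?I = "\<lambda>n::nat. indicator (ball 0 (real n)) :: 'a \<Rightarrow> ennreal"
  have "(\<integral>\<^sup>+x. f (\<omega>, x) \<partial>count_space (pp \<omega>))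
      = (SUP n. \<integral>\<^sup>+x. f (\<omega>, x) * ?I n x \<partial>count_space (pp \<omega>))" for \<omega>
  proof -
    have inc: "incseq (\<lambda>n x. f (\<omega>, x) * ?I n x)"
      by (auto simp: incseq_def le_fun_def indicator_def)
    have "(SUP n. f (\<omega>, x) * ?I n x) = f (\<omega>, x)" for x
    proof (rule antisym)
      obtain n :: nat where "norm x < real n" using reals_Archimedean2 by blast
      then have "f (\<omega>, x) \<le> f (\<omega>, x) * ?I n x" by (simp add: indicator_def)
      then show "f (\<omega>, x) \<le> (SUP n. f (\<omega>, x) * ?I n x)" by (rule SUP_upper2[OF UNIV_I])
    qed (auto intro!: SUP_least simp: indicator_def)
    then have "(\<integral>\<^sup>+x. f (\<omega>, x) \<partial>count_space (pp \<omega>))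
        = (\<integral>\<^sup>+x. (SUP n. f (\<omega>, x) * ?I n x) \<partial>count_space (pp \<omega>))" by simp
    also have "\<dots> = (SUP n. \<integral>\<^sup>+x. f (\<omega>, x) * ?I n x \<partial>count_space (pp \<omega>))"
      by (rule nn_integral_monotone_convergence_SUP[OF inc]) simp
    finally show ?thesis .
  qed
  moreover have "(\<lambda>\<omega>. \<integral>\<^sup>+x. f (\<omega>, x) * ?I n x \<partial>count_space (pp \<omega>)) \<in> borel_measurable M" for n
    by (intro measurable_count_sum_bounded[OF pp _ _ f]) auto
  ultimately show ?thesis by simp
qed

section \<open>Half-open boxes and the integer grid\<close>

text \<open>Half-open, so that the unit cells at integer points tile the space without shared faces.
  This makes the dichotomy \<open>ucell_qbox_cases\<close> exact.\<close>

definition hbox :: "'a::euclidean_space \<Rightarrow> 'a \<Rightarrow> 'a set" where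
  "hbox a b = {x. \<forall>i\<in>Basis. a \<bullet> i \<le> x \<bullet> i \<and> x \<bullet> i < b \<bullet> i}"

definition ints :: "'a::euclidean_space set" where
  "ints = {z. \<forall>i\<in>Basis. z \<bullet> i \<in> \<int>}"

definition intbox :: "nat \<Rightarrow> 'a::euclidean_space set" where
  "intbox N = {z\<in>ints. \<forall>i\<in>Basis. \<bar>z \<bullet> i\<bar> \<le> real N}"

abbreviation "ucell j \<equiv> hbox j (j + One)"
abbreviation "qbox z l \<equiv> hbox (z - l *\<^sub>R One) (z + l *\<^sub>R One)"

lemma hbox_borel [measurable]: "hbox a b \<in> sets borel"
proof -
  have "hbox a b = (\<Inter>i\<in>Basis. {x. a \<bullet> i \<le> x \<bullet> i} \<inter> {x. x \<bullet> i < b \<bullet> i})"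
    unfolding hbox_def by auto
  also have "\<dots> \<in> sets borel"
    by (intro sets.finite_INT sets.Int borel_closed borel_open closed_Collect_le open_Collect_less
        continuous_intros) auto
  finally show ?thesis .
qed

lemma bounded_hbox: "bounded (hbox a b)"
  by (rule bounded_subset[OF bounded_cbox[of a b]]) (auto simp: hbox_def mem_box less_imp_le)

lemma hbox_translate: "(\<lambda>y. y + x) ` hbox a b = hbox (a + x) (b + x)"
proof -
  have "y \<in> (\<lambda>y. y + x) ` hbox a b" if "y \<in> hbox (a + x) (b + x)" for y
    using that by (intro image_eqI[of _ _ "y - x"]) (auto simp: hbox_def algebra_simps)
  then show ?thesis by (auto simp: hbox_def inner_add_left)
qed

lemma Lambda_borel [measurable]: "Lambda r \<in> sets borel"
  unfolding Lambda_def by simp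

lemma mem_Lambda: "x \<in> Lambda r \<longleftrightarrow> (\<forall>i\<in>Basis. \<bar>x \<bullet> i\<bar> \<le> r)"
  unfolding Lambda_def mem_box by (auto simp: abs_le_iff)

lemma unit_cube_borel [measurable]: "unit_cube \<in> sets borel"
  unfolding unit_cube_def by simp

lemma finite_intbox: "finite (intbox N :: 'a::euclidean_space set)"
  and card_intbox: "card (intbox N :: 'a set) \<le> (2 * N + 1) ^ DIM('a)"
proof -
  let ?S = "PiE (Basis :: 'a set) (\<lambda>_. {- int N..int N})"
  let ?f = "\<lambda>z::'a. restrict (\<lambda>i. \<lfloor>z \<bullet> i\<rfloor>) Basis"
  have "inj_on ?f (intbox N)"
  proof (rule inj_onI)
    fix x y :: 'a assume xy: "x \<in> intbox N" "y \<in> intbox N" "?f x = ?f y"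
    show "x = y"
    proof (rule euclidean_eqI)
      fix i :: 'a assume i: "i \<in> Basis"
      then have "\<lfloor>x \<bullet> i\<rfloor> = \<lfloor>y \<bullet> i\<rfloor>" using fun_cong[OF xy(3), of i] by simp
      then show "x \<bullet> i = y \<bullet> i"
        using xy i by (auto simp: intbox_def ints_def elim!: Ints_cases)
    qed
  qed
  moreover have "?f ` intbox N \<subseteq> ?S"
    by (auto simp: intbox_def abs_le_iff le_floor_iff floor_le_iff)
  moreover have "finite ?S" by (intro finite_PiE) auto
  moreover have "card {- int N..int N} = 2 * N + 1" by simp
  then have "card ?S = (2 * N + 1) ^ DIM('a)" by (simp only: card_PiE[OF finite_Basis] prod_constant)
  ultimately show "finite (intbox N :: 'a set)" "card (intbox N :: 'a set) \<le> (2 * N + 1) ^ DIM('a)"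
    using card_inj_on_le[of ?f "intbox N" ?S] inj_on_finite[of ?f "intbox N" ?S] by simp_all
qed

lemma floor_vec:
  fixes w :: "'a::euclidean_space"
  defines "z \<equiv> (\<Sum>i\<in>Basis. of_int \<lfloor>w \<bullet> i\<rfloor> *\<^sub>R i)"
  shows "z \<in> ints" "w \<in> ucell z" "i \<in> Basis \<Longrightarrow> z \<bullet> i = of_int \<lfloor>w \<bullet> i\<rfloor>"
  unfolding z_def ints_def hbox_def
  by (auto simp: inner_add_left)

text \<open>The index N itself has to be allowed: \<open>Lambda\<close> is closed, and a point with
  a coordinate equal to N lies in a cell with that index.\<close>

lemma Lambda_cover: "Lambda (real N) \<subseteq> (\<Union>j\<in>intbox N. ucell j)"
proof
  fix w :: 'a assume w: "w \<in> Lambda (real N)"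
  let ?z = "\<Sum>i\<in>Basis. of_int \<lfloor>w \<bullet> i\<rfloor> *\<^sub>R i"
  have "\<bar>of_int \<lfloor>w \<bullet> i\<rfloor>\<bar> \<le> real N" if "i \<in> Basis" for i
  proof -
    have "- real N \<le> w \<bullet> i" "w \<bullet> i \<le> real N"
      using w that by (auto simp: mem_Lambda abs_le_iff)
    then have "- int N \<le> \<lfloor>w \<bullet> i\<rfloor>" "\<lfloor>w \<bullet> i\<rfloor> \<le> int N"
      by (simp_all add: le_floor_iff floor_le_iff)
    then show ?thesis by (simp add: abs_le_iff)
  qed
  then have "?z \<in> intbox N" using floor_vec[of w] by (auto simp: intbox_def)
  then show "w \<in> (\<Union>j\<in>intbox N. ucell j)" using floor_vec(2)[of w] by auto
qed

lemma unit_cube_subset_Lambda: "unit_cube \<subseteq> Lambda 1"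
  by (auto simp: unit_cube_def mem_Lambda mem_box)

text \<open>All corners are integers, so in each coordinate a common point turns strict real
  inequalities between corners into integer inequalities with a gain of 1. Positive association,
  which speaks of disjoint sets, becomes applicable through this dichotomy.\<close>

lemma ucell_qbox_cases:
  assumes "j \<in> ints" "z \<in> ints"
  shows "ucell j \<subseteq> qbox z (real l) \<or> ucell j \<inter> qbox z (real l) = {}"
proof (rule disjCI)
  assume "ucell j \<inter> qbox z (real l) \<noteq> {}"
  then obtain x where x: "x \<in> ucell j" "x \<in> qbox z (real l)" by auto
  show "ucell j \<subseteq> qbox z (real l)"
  proof
    fix y assume y: "y \<in> ucell j"
    have "z \<bullet> i - l \<le> y \<bullet> i \<and> y \<bullet> i < z \<bullet> i + l" if i: "i \<in> Basis" for i
    proof -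
      have "j \<bullet> i \<in> \<int>" "z \<bullet> i \<in> \<int>" using assms i by (auto simp: ints_def)
      then obtain a b :: int where ab: "j \<bullet> i = a" "z \<bullet> i = b" by (auto elim!: Ints_cases)
      have "real_of_int a \<le> x \<bullet> i" "x \<bullet> i < a + 1" "b - real l \<le> x \<bullet> i" "x \<bullet> i < b + real l"
        using x i ab by (auto simp: hbox_def inner_add_left inner_diff_left)
      then have "b - int l \<le> a" "a + 1 \<le> b + int l" by linarith+
      moreover have "a \<le> y \<bullet> i" "y \<bullet> i < a + 1"
        using y i ab by (auto simp: hbox_def inner_add_left)
      ultimately show ?thesis unfolding ab by linarith
    qed
    then show "y \<in> qbox z (real l)" by (auto simp: hbox_def inner_add_left inner_diff_left)
  qed
qed

text \<open>The Palm formula moves a box by a random point \<open>y\<close> of the unit cube. With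
  one unit of margin the moved box still covers a fixed one, so a void event depending on
  \<open>y\<close> implies one that does not.\<close>

lemma unit_cube_translate_qbox:
  assumes "y \<in> unit_cube"
  shows "qbox z l \<subseteq> (\<lambda>v. v + y) ` qbox z (l + 1)"
proof
  fix w assume w: "w \<in> qbox z l"
  have "z \<bullet> i - (l + 1) + y \<bullet> i \<le> w \<bullet> i \<and> w \<bullet> i < z \<bullet> i + (l + 1) + y \<bullet> i" if i: "i \<in> Basis" for i
  proof -
    have "0 \<le> y \<bullet> i" "y \<bullet> i \<le> 1" "z \<bullet> i - l \<le> w \<bullet> i" "w \<bullet> i < z \<bullet> i + l"
      using assms w i by (auto simp: hbox_def unit_cube_def mem_box inner_add_left inner_diff_left)
    then show ?thesis by linarith
  qed
  then show "w \<in> (\<lambda>v. v + y) ` qbox z (l + 1)"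
    unfolding hbox_translate by (simp add: hbox_def inner_add_left inner_diff_left)
qed

lemma unit_cube_translate_Lambda:
  assumes "y \<in> unit_cube"
  shows "(\<lambda>v. v + y) ` Lambda r \<subseteq> Lambda (r + 1)"
proof
  fix w assume "w \<in> (\<lambda>v. v + y) ` Lambda r"
  then obtain v where v: "w = v + y" "v \<in> Lambda r" by auto
  have "\<bar>(v + y) \<bullet> i\<bar> \<le> r + 1" if i: "i \<in> Basis" for i
  proof -
    have "0 \<le> y \<bullet> i" "y \<bullet> i \<le> 1" "\<bar>v \<bullet> i\<bar> \<le> r"
      using assms v(2) i by (auto simp: unit_cube_def mem_box mem_Lambda)
    then show ?thesis unfolding inner_add_left by linarith
  qed
  then show "w \<in> Lambda (r + 1)" unfolding v mem_Lambda by blast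
qed

section \<open>Stationary point processes and the Palm distribution\<close>

lemma nn_integral_count_space_Int:
  "(\<integral>\<^sup>+x. f x \<partial>count_space (A \<inter> B)) = (\<integral>\<^sup>+x. f x * indicator B x \<partial>count_space A)"
proof -
  have "(\<integral>\<^sup>+x. f x \<partial>count_space (A \<inter> B)) = (\<integral>\<^sup>+x. f x * indicator (A \<inter> B) x \<partial>count_space UNIV)"
    by (rule nn_integral_count_space_indicator) simp
  also have "\<dots> = (\<integral>\<^sup>+x. f x * indicator B x * indicator A x \<partial>count_space UNIV)"
    by (intro nn_integral_cong) (auto simp: indicator_def)
  also have "\<dots> = (\<integral>\<^sup>+x. f x * indicator B x \<partial>count_space A)"
    by (rule nn_integral_count_space_indicator[symmetric]) simp
  finally show ?thesis .
qed

lemma ennreal_mult_le_sum_squares: "x * y \<le> x\<^sup>2 + y\<^sup>2" for x y :: ennreal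
proof (cases "x \<le> y")
  case True
  then have "x * y \<le> y * y" by (rule mult_right_mono) simp
  then show ?thesis by (simp add: power2_eq_square add_increasing)
next
  case False
  then have "x * y \<le> x * x" by (intro mult_left_mono) auto
  then show ?thesis by (simp add: power2_eq_square add_increasing2)
qed

text \<open>In \<open>pp_cov\<close> the shift is quantified inside the almost sure statement,
  because the Palm formula shifts by points of the configuration, which depend on \<omega>.\<close>

locale stationary_pp = prob_space M
  for M :: "'w measure" +
  fixes \<theta> :: "'a::euclidean_space \<Rightarrow> 'w \<Rightarrow> 'w" and pp :: "'w \<Rightarrow> 'a set"
  assumes act_meas: "(\<lambda>(x, \<omega>). \<theta> x \<omega>) \<in> measurable (borel \<Otimes>\<^sub>M M) M"
    and pp_meas [measurable]: "pp \<in> measurable M N_space"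
    and act_inv: "\<And>x. distr M M (\<theta> x) = M"
    and pp_cov: "AE \<omega> in M. \<forall>x. pp (\<theta> x \<omega>) = (\<lambda>y. y - x) ` pp \<omega>"
begin

abbreviation "P0 \<equiv> Palm M \<theta> pp"

lemma pp_loc_fin: "\<omega> \<in> space M \<Longrightarrow> pp \<omega> \<in> loc_fin"
  using measurable_space[OF pp_meas] by (simp add: space_N_space)

lemma theta_meas [measurable]: "\<theta> x \<in> measurable M M"
  using measurable_compose[OF measurable_Pair1' act_meas, of x] by simp

text \<open>The free function \<open>h\<close> serves void probabilities (an indicator of 0) and
  moments (a power) alike.\<close>

lemma stationary:
  assumes [measurable]: "B \<in> sets borel" "h \<in> borel_measurable borel"
  shows "(\<integral>\<^sup>+\<omega>. h (pcount (pp \<omega>) ((\<lambda>y. y + x) ` B)) \<partial>M) = (\<integral>\<^sup>+\<omega>. h (pcount (pp \<omega>) B) \<partial>M)"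
proof -
  have "(\<integral>\<^sup>+\<omega>. h (pcount (pp \<omega>) B) \<partial>M) = (\<integral>\<^sup>+\<omega>. h (pcount (pp \<omega>) B) \<partial>distr M M (\<theta> x))"
    by (simp add: act_inv)
  also have "\<dots> = (\<integral>\<^sup>+\<omega>. h (pcount (pp (\<theta> x \<omega>)) B) \<partial>M)"
    by (rule nn_integral_distr) measurable
  also have "\<dots> = (\<integral>\<^sup>+\<omega>. h (pcount (pp \<omega>) ((\<lambda>y. y + x) ` B)) \<partial>M)"
    using pp_cov by (intro nn_integral_cong_AE) (auto simp: pcount_translate)
  finally show ?thesis ..
qed

lemma measurable_Palm_sum:
  assumes "F \<in> borel_measurable M"
  shows "(\<lambda>\<omega>. \<integral>\<^sup>+x. F (\<theta> x \<omega>) \<partial>count_space (pp \<omega> \<inter> unit_cube)) \<in> borel_measurable M"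
proof -
  have "(\<lambda>p. \<theta> (snd p) (fst p)) \<in> measurable (M \<Otimes>\<^sub>M borel) M"
    using measurable_compose[OF measurable_pair_swap' act_meas] by (simp add: case_prod_beta')
  then have "(\<lambda>p. F (\<theta> (snd p) (fst p)) * indicator unit_cube (snd p)) \<in> borel_measurable (M \<Otimes>\<^sub>M borel)"
    using assms by measurable
  from measurable_count_sum[OF pp_meas this] show ?thesis
    by (simp add: nn_integral_count_space_Int)
qed

lemma sets_Palm [simp, measurable_cong]: "sets P0 = sets M"
  and space_Palm [simp]: "space P0 = space M"
  unfolding Palm_def
  by (simp_all add: sets.sigma_sets_eq sets.space_closed sets_measure_of space_measure_of)

text \<open>\<open>Palm\<close> is built with \<open>measure_of\<close>, which returns the given set
  function only if that function is countably additive. This is checked here by exchanging the sum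
  with both integrals.\<close>

lemma emeasure_Palm:
  assumes "A \<in> sets M"
  shows "emeasure P0 A
    = (\<integral>\<^sup>+\<omega>. (\<integral>\<^sup>+x. indicator A (\<theta> x \<omega>) \<partial>count_space (pp \<omega> \<inter> unit_cube)) \<partial>M) / intensity M pp"
proof (rule emeasure_measure_of[OF Palm_def])
  let ?\<mu> = "\<lambda>A. (\<integral>\<^sup>+\<omega>. (\<integral>\<^sup>+x. indicator A (\<theta> x \<omega>) \<partial>count_space (pp \<omega> \<inter> unit_cube)) \<partial>M) / intensity M pp"
  show "positive (sets P0) ?\<mu>" by (simp add: positive_def)
  show "countably_additive (sets P0) ?\<mu>"
  proof (rule countably_additiveI)
    fix A :: "nat \<Rightarrow> 'w set" assume A: "range A \<subseteq> sets P0" "disjoint_family A"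
    have "(\<integral>\<^sup>+\<omega>. (\<integral>\<^sup>+x. indicator (\<Union>i. A i) (\<theta> x \<omega>) \<partial>count_space (pp \<omega> \<inter> unit_cube)) \<partial>M)
       = (\<integral>\<^sup>+\<omega>. (\<Sum>i. \<integral>\<^sup>+x. indicator (A i) (\<theta> x \<omega>) \<partial>count_space (pp \<omega> \<inter> unit_cube)) \<partial>M)"
      unfolding suminf_indicator[OF A(2), symmetric]
      by (intro nn_integral_cong nn_integral_suminf) simp
    also have "\<dots> = (\<Sum>i. \<integral>\<^sup>+\<omega>. \<integral>\<^sup>+x. indicator (A i) (\<theta> x \<omega>) \<partial>count_space (pp \<omega> \<inter> unit_cube) \<partial>M)"
      using A(1) by (intro nn_integral_suminf measurable_Palm_sum borel_measurable_indicator) auto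
    finally show "(\<Sum>i. ?\<mu> (A i)) = ?\<mu> (\<Union>i. A i)"
      by (simp add: divide_ennreal_def ennreal_suminf_multc)
  qed
qed (use assms sets.sets_into_space in auto)

text \<open>The Campbell formula, by extension from sets to functions. It is the passage from every
  expectation under \<open>P0\<close> to one under \<open>M\<close>.\<close>

lemma nn_integral_Palm:
  assumes "F \<in> borel_measurable M"
  shows "(\<integral>\<^sup>+\<omega>. F \<omega> \<partial>P0)
    = (\<integral>\<^sup>+\<omega>. (\<integral>\<^sup>+x. F (\<theta> x \<omega>) \<partial>count_space (pp \<omega> \<inter> unit_cube)) \<partial>M) / intensity M pp"
  using assms
proof (induction rule: borel_measurable_induct)
  case (cong f g)
  have "(\<integral>\<^sup>+\<omega>. f \<omega> \<partial>P0) = (\<integral>\<^sup>+\<omega>. g \<omega> \<partial>P0)"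
    using cong(3) by (intro nn_integral_cong) simp
  moreover have "(\<integral>\<^sup>+\<omega>. (\<integral>\<^sup>+x. f (\<theta> x \<omega>) \<partial>count_space (pp \<omega> \<inter> unit_cube)) \<partial>M)
    = (\<integral>\<^sup>+\<omega>. (\<integral>\<^sup>+x. g (\<theta> x \<omega>) \<partial>count_space (pp \<omega> \<inter> unit_cube)) \<partial>M)"
    using cong(3) measurable_space[OF theta_meas] by (intro nn_integral_cong) simp
  ultimately show ?case using cong(4) by simp
next
  case (set A)
  then show ?case by (simp add: emeasure_Palm)
next
  case (mult u c)
  have u: "u \<in> borel_measurable P0" using mult(2) by measurable
  show ?case
    using mult.IH nn_integral_cmult[OF u] nn_integral_cmult[OF measurable_Palm_sum[OF mult(2)]]
    by (simp add: nn_integral_cmult divide_ennreal_def mult.assoc)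
next
  case (add u v)
  have uM: "u \<in> borel_measurable M" "v \<in> borel_measurable M" using add by auto
  then have uv: "u \<in> borel_measurable P0" "v \<in> borel_measurable P0" by measurable
  show ?case
    using add nn_integral_add[OF uv]
      nn_integral_add[OF measurable_Palm_sum[OF uM(2)] measurable_Palm_sum[OF uM(1)]]
    by (simp add: nn_integral_add divide_ennreal_def distrib_right)
next
  case (seq U)
  have U: "U i \<in> borel_measurable P0" for i using seq(1)[of i] by measurable
  have inc: "incseq (\<lambda>i x. U i (\<theta> x \<omega>))" for \<omega>
    using seq(3) by (auto simp: incseq_def le_fun_def)
  have "(\<integral>\<^sup>+\<omega>. (SUP i. U i) \<omega> \<partial>P0) = (\<integral>\<^sup>+\<omega>. (SUP i. U i \<omega>) \<partial>P0)"
    by (simp add: image_comp)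
  also have "\<dots> = (SUP i. \<integral>\<^sup>+\<omega>. U i \<omega> \<partial>P0)"
    by (rule nn_integral_monotone_convergence_SUP[OF seq(3) U])
  also have "\<dots> = (SUP i. \<integral>\<^sup>+\<omega>. (\<integral>\<^sup>+x. U i (\<theta> x \<omega>) \<partial>count_space (pp \<omega> \<inter> unit_cube)) \<partial>M) / intensity M pp"
    using seq by (simp add: divide_ennreal_def SUP_mult_right_ennreal)
  also have "(SUP i. \<integral>\<^sup>+\<omega>. (\<integral>\<^sup>+x. U i (\<theta> x \<omega>) \<partial>count_space (pp \<omega> \<inter> unit_cube)) \<partial>M)
    = (\<integral>\<^sup>+\<omega>. (SUP i. \<integral>\<^sup>+x. U i (\<theta> x \<omega>) \<partial>count_space (pp \<omega> \<inter> unit_cube)) \<partial>M)"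
    using seq(1) inc
    by (intro nn_integral_monotone_convergence_SUP[symmetric] measurable_Palm_sum)
       (auto simp: incseq_def le_fun_def intro!: nn_integral_mono)
  also have "\<dots> = (\<integral>\<^sup>+\<omega>. \<integral>\<^sup>+x. (SUP i. U i (\<theta> x \<omega>)) \<partial>count_space (pp \<omega> \<inter> unit_cube) \<partial>M)"
    by (intro nn_integral_cong nn_integral_monotone_convergence_SUP[symmetric] inc) simp
  finally show ?case by (simp add: image_comp)
qed

text \<open>The outer Palm sum contributes the count of the unit cube, covered by at most 3^d cells.
  The inner count is that of \<open>Lambda R\<close> moved by a point of the unit cube, hence inside
  \<open>Lambda (R + 1)\<close> with at most (2 R + 3)^d cells. Each product of two cell counts is
  bounded by two squares, whence the factor 2.\<close>

lemma Palm_count_bound: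
  fixes V V' :: "'a set"
  assumes [measurable]: "V \<in> sets borel" "V' \<in> sets borel"
    and sub: "\<And>y. y \<in> unit_cube \<Longrightarrow> V' \<subseteq> (\<lambda>v. v + y) ` V"
    and \<epsilon>: "\<And>j. j \<in> ints \<Longrightarrow>
      (\<integral>\<^sup>+\<omega>. (pcount (pp \<omega>) (ucell j))\<^sup>2 * indicator {0} (pcount (pp \<omega>) V') \<partial>M) \<le> \<epsilon>"
  shows "(\<integral>\<^sup>+\<omega>. pcount (pp \<omega>) (Lambda (real R)) * indicator {0} (pcount (pp \<omega>) V) \<partial>P0)
    \<le> of_nat (2 * 3 ^ DIM('a) * (2 * R + 3) ^ DIM('a)) * \<epsilon> / intensity M pp"
proof -
  let ?I = "\<lambda>\<omega>. indicator {0} (pcount (pp \<omega>) V') :: ennreal"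
  let ?N = "\<lambda>\<omega> j. pcount (pp \<omega>) (ucell j)"
  let ?F = "\<lambda>\<omega>. pcount (pp \<omega>) (Lambda (real R)) * indicator {0} (pcount (pp \<omega>) V) :: ennreal"
  have pt: "(\<integral>\<^sup>+x. ?F (\<theta> x \<omega>) \<partial>count_space (pp \<omega> \<inter> unit_cube))
     \<le> (\<Sum>i\<in>intbox 1. \<Sum>j\<in>intbox (R+1). (?N \<omega> i)\<^sup>2 * ?I \<omega> + (?N \<omega> j)\<^sup>2 * ?I \<omega>)"
    if cov: "\<forall>x. pp (\<theta> x \<omega>) = (\<lambda>y. y - x) ` pp \<omega>" for \<omega>
  proof -
    let ?L = "pcount (pp \<omega>) (Lambda (real (R + 1)))"
    have "(\<integral>\<^sup>+x. ?F (\<theta> x \<omega>) \<partial>count_space (pp \<omega> \<inter> unit_cube))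
        \<le> (\<integral>\<^sup>+x. ?L * ?I \<omega> * indicator unit_cube x \<partial>count_space (pp \<omega>))"
      unfolding nn_integral_count_space_Int
    proof (rule nn_integral_mono)
      fix x assume "x \<in> space (count_space (pp \<omega>))"
      show "?F (\<theta> x \<omega>) * indicator unit_cube x \<le> ?L * ?I \<omega> * indicator unit_cube x"
      proof (cases "x \<in> unit_cube")
        case True
        have "pcount (pp (\<theta> x \<omega>)) (Lambda (real R)) \<le> ?L"
          using pcount_mono[OF unit_cube_translate_Lambda[OF True, of "real R"]] cov
          by (simp add: pcount_translate add.commute)
        moreover have "indicator {0} (pcount (pp (\<theta> x \<omega>)) V) \<le> ?I \<omega>"
          using pcount_mono[OF sub[OF True], of "pp \<omega>"] cov
          by (auto simp: pcount_translate indicator_def)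
        ultimately show ?thesis using True by (simp add: mult_mono)
      qed simp
    qed
    \<comment> \<open>The integrand no longer depends on the recentring point, so summing over the
      points of the unit cube just counts them.\<close>
    also have "\<dots> = ?L * ?I \<omega> * pcount (pp \<omega>) unit_cube"
      by (simp add: nn_integral_cmult nn_integral_count_indicator)
    also have "\<dots> \<le> (\<Sum>j\<in>intbox (R+1). ?N \<omega> j) * ?I \<omega> * (\<Sum>i\<in>intbox 1. ?N \<omega> i)"
      using Lambda_cover[of "R + 1"] Lambda_cover[of 1] unit_cube_subset_Lambda
      by (intro mult_mono pcount_le_sum finite_intbox) auto
    also have "\<dots> = (\<Sum>i\<in>intbox 1. \<Sum>j\<in>intbox (R+1). (?N \<omega> i * ?N \<omega> j) * ?I \<omega>)"
      by (subst sum.swap) (simp add: sum_distrib_left sum_distrib_right mult_ac)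
    also have "\<dots> \<le> (\<Sum>i\<in>intbox 1. \<Sum>j\<in>intbox (R+1). ((?N \<omega> i)\<^sup>2 + (?N \<omega> j)\<^sup>2) * ?I \<omega>)"
      by (intro sum_mono mult_right_mono ennreal_mult_le_sum_squares) simp
    finally show ?thesis by (simp add: distrib_right)
  qed
  have "(\<integral>\<^sup>+\<omega>. ?F \<omega> \<partial>P0)
    = (\<integral>\<^sup>+\<omega>. (\<integral>\<^sup>+x. ?F (\<theta> x \<omega>) \<partial>count_space (pp \<omega> \<inter> unit_cube)) \<partial>M) / intensity M pp"
    by (rule nn_integral_Palm) measurable
  also have "(\<integral>\<^sup>+\<omega>. (\<integral>\<^sup>+x. ?F (\<theta> x \<omega>) \<partial>count_space (pp \<omega> \<inter> unit_cube)) \<partial>M)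
    \<le> (\<integral>\<^sup>+\<omega>. (\<Sum>i\<in>intbox 1. \<Sum>j\<in>intbox (R+1). (?N \<omega> i)\<^sup>2 * ?I \<omega> + (?N \<omega> j)\<^sup>2 * ?I \<omega>) \<partial>M)"
    by (intro nn_integral_mono_AE eventually_mono[OF pp_cov]) (rule pt)
  also have "\<dots> = (\<Sum>i\<in>intbox 1. \<Sum>j\<in>intbox (R+1).
      (\<integral>\<^sup>+\<omega>. (?N \<omega> i)\<^sup>2 * ?I \<omega> \<partial>M) + (\<integral>\<^sup>+\<omega>. (?N \<omega> j)\<^sup>2 * ?I \<omega> \<partial>M))"
    by (simp add: nn_integral_sum nn_integral_add)
  also have "\<dots> \<le> (\<Sum>i\<in>(intbox 1 :: 'a set). \<Sum>j\<in>(intbox (R+1) :: 'a set). \<epsilon> + \<epsilon>)"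
    by (intro sum_mono add_mono \<epsilon>) (auto simp: intbox_def)
  also have "\<dots> = of_nat (2 * card (intbox 1 :: 'a set) * card (intbox (R+1) :: 'a set)) * \<epsilon>"
    by (simp add: mult_ac mult_2 distrib_left distrib_right)
  also have "\<dots> \<le> of_nat (2 * 3 ^ DIM('a) * (2 * R + 3) ^ DIM('a)) * \<epsilon>"
    using card_intbox[where 'a='a, of 1] card_intbox[where 'a='a, of "R+1"]
    by (intro mult_right_mono of_nat_mono mult_mono) (auto simp: numeral_3_eq_3)
  finally show ?thesis by (auto intro: divide_right_mono_ennreal)
qed

end

section \<open>Second moments on void events\<close>

lemma epow_2: "epow t 2 = t\<^sup>2"
proof (cases t)
  case (real r)
  then show ?thesis by (simp add: epow_def ennreal_power)
qed (simp add: epow_def)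

lemma epow_mono: "s \<le> t \<Longrightarrow> 0 \<le> \<gamma> \<Longrightarrow> epow s \<gamma> \<le> epow t \<gamma>"
  by (cases s; cases t) (auto simp: epow_def top_unique intro!: powr_mono2 ennreal_leI)

lemma borel_measurable_epow [measurable]: "(\<lambda>t. epow t \<gamma>) \<in> borel_measurable borel"
  unfolding epow_def by measurable

text \<open>Truncation at T: up to T the square is at most T^2; beyond T it equals t^(2 - \<gamma>)
  t^\<gamma>, and the first factor decreases in t.\<close>

lemma square_le_epow:
  assumes "\<gamma> \<ge> 2" "T > 0"
  shows "t\<^sup>2 \<le> ennreal (T\<^sup>2) + ennreal (T powr (2 - \<gamma>)) * epow t \<gamma>"
proof (cases t)
  case (real r)
  have "r\<^sup>2 \<le> T\<^sup>2 + T powr (2 - \<gamma>) * r powr \<gamma>"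
  proof (cases "r \<le> T")
    case True
    then have "r\<^sup>2 \<le> T\<^sup>2" using real by (intro power_mono) auto
    then show ?thesis by (simp add: add_increasing2)
  next
    case False
    then have "r powr (2 - \<gamma>) \<le> T powr (2 - \<gamma>)"
      using assms by (intro powr_mono2') auto
    then have "r powr (2 - \<gamma>) * r powr \<gamma> \<le> T powr (2 - \<gamma>) * r powr \<gamma>"
      by (intro mult_right_mono) auto
    moreover have "r powr (2 - \<gamma>) * r powr \<gamma> = r\<^sup>2"
      using False assms by (simp flip: powr_add)
    ultimately show ?thesis by (simp add: add_increasing)
  qed
  then show ?thesis using real
    by (simp add: epow_def ennreal_power flip: ennreal_mult ennreal_plus)
next
  case top
  then show ?thesis using assms by (simp add: epow_def ennreal_mult_top)
qed

context stationary_pp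
begin

abbreviation "Q \<equiv> distr M N_space pp"

abbreviation void :: "'a set \<Rightarrow> ennreal" where
  "void B \<equiv> (\<integral>\<^sup>+\<omega>. indicator {0} (pcount (pp \<omega>) B) \<partial>M)"

abbreviation void_moment :: "'a set \<Rightarrow> 'a set \<Rightarrow> ennreal" where
  "void_moment U B \<equiv> (\<integral>\<^sup>+\<omega>. (pcount (pp \<omega>) U)\<^sup>2 * indicator {0} (pcount (pp \<omega>) B) \<partial>M)"

lemma ucell_moment:
  assumes "0 \<le> \<gamma>"
  shows "(\<integral>\<^sup>+\<omega>. epow (pcount (pp \<omega>) (ucell j)) \<gamma> \<partial>M) \<le> rho M pp \<gamma>"
proof -
  have "(\<integral>\<^sup>+\<omega>. epow (pcount (pp \<omega>) (ucell j)) \<gamma> \<partial>M)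
      = (\<integral>\<^sup>+\<omega>. epow (pcount (pp \<omega>) ((\<lambda>y. y + j) ` hbox 0 One)) \<gamma> \<partial>M)"
    by (simp add: hbox_translate add.commute)
  also have "\<dots> = (\<integral>\<^sup>+\<omega>. epow (pcount (pp \<omega>) (hbox 0 One)) \<gamma> \<partial>M)"
    by (rule stationary) measurable
  also have "\<dots> \<le> rho M pp \<gamma>"
    unfolding rho_def using assms
    by (intro nn_integral_mono epow_mono pcount_mono)
       (auto simp: hbox_def unit_cube_def mem_box less_imp_le)
  finally show ?thesis .
qed

lemma ucell_square_moment: "(\<integral>\<^sup>+\<omega>. (pcount (pp \<omega>) (ucell j))\<^sup>2 \<partial>M) \<le> rho M pp 2"
  using ucell_moment[of 2 j] by (simp add: epow_2)

lemma void_translate: "B \<in> sets borel \<Longrightarrow> void ((\<lambda>y. y + x) ` B) = void B"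
  by (intro stationary) auto

lemma void_antimono: "A \<subseteq> B \<Longrightarrow> void B \<le> void A"
  by (intro nn_integral_mono) (auto simp: indicator_def pcount_eq_0_iff)

lemma void_le_1: "void B \<le> 1"
proof -
  have "void B \<le> (\<integral>\<^sup>+\<omega>. 1 \<partial>M)" by (intro nn_integral_mono) (auto simp: indicator_def)
  then show ?thesis by (simp add: emeasure_space_1)
qed

lemma void_eq_emeasure:
  assumes [measurable]: "B \<in> sets borel"
  shows "void B = emeasure M {\<omega>\<in>space M. pcount (pp \<omega>) B = 0}"
proof -
  have "void B = (\<integral>\<^sup>+\<omega>. indicator {\<omega>\<in>space M. pcount (pp \<omega>) B = 0} \<omega> \<partial>M)"
    by (intro nn_integral_cong) (auto simp: indicator_def)
  also have "\<dots> = emeasure M {\<omega>\<in>space M. pcount (pp \<omega>) B = 0}"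
    by (rule nn_integral_indicator) measurable
  finally show ?thesis .
qed

text \<open>Condition C concerns closed boxes centred at 0. Stationarity moves the centre, and
  halving the side fits a closed box into the half-open one.\<close>

lemma condC_void:
  assumes "condC Q \<alpha>" "\<alpha> \<ge> 0"
  shows "\<exists>K\<ge>0. \<forall>z. \<forall>l\<ge>1. void (qbox z (real l)) \<le> ennreal (K * real l powr (- \<alpha>))"
proof -
  obtain \<kappa> where \<kappa>: "\<kappa> > 0"
    "\<And>l. l \<ge> 1 \<Longrightarrow> measure Q {\<xi> \<in> space Q. pcount \<xi> (Lambda l) = 0} \<le> \<kappa> * l powr (- \<alpha>)"
    using assms(1) unfolding condC_def by blast
  have vL: "void (Lambda l) \<le> ennreal (\<kappa> * l powr (- \<alpha>))" if "l \<ge> 1" for l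
  proof -
    have "measure Q {\<xi> \<in> space Q. pcount \<xi> (Lambda l) = 0}
       = measure M {\<omega>\<in>space M. pcount (pp \<omega>) (Lambda l) = 0}"
      by (subst measure_distr) (auto intro!: arg_cong[where f="measure M"] measurable_space[OF pp_meas])
    then show ?thesis
      using \<kappa>(2)[OF that] by (simp add: void_eq_emeasure emeasure_eq_measure ennreal_leI)
  qed
  \<comment> \<open>The factor \<open>2 powr \<alpha>\<close> pays for the halving. The maximum with
    1 covers l = 1, where half the side is too small for Condition C and only the trivial bound
    \<open>void_le_1\<close> is available.\<close>
  define K where "K = max \<kappa> 1 * 2 powr \<alpha>"
  have "void (qbox z (real l)) \<le> ennreal (K * real l powr (- \<alpha>))" if "l \<ge> 1" for z and l :: nat
  proof (cases "l = 1")
    case True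
    have "1 * 1 \<le> max \<kappa> 1 * 2 powr \<alpha>" using assms(2) by (intro mult_mono) (auto simp: ge_one_powr_ge_zero)
    then have "ennreal 1 \<le> ennreal K" unfolding K_def by (intro ennreal_leI) simp
    with True show ?thesis using order_trans[OF void_le_1] by simp
  next
    case False
    then have l: "real l / 2 \<ge> 1" using that by simp
    have "(\<lambda>y. y + z) ` Lambda (real l / 2) \<subseteq> qbox z (real l)"
    proof
      fix w assume "w \<in> (\<lambda>y. y + z) ` Lambda (real l / 2)"
      then obtain y where y: "w = y + z" "\<forall>i\<in>Basis. \<bar>y \<bullet> i\<bar> \<le> real l / 2" by (auto simp: mem_Lambda)
      have "z \<bullet> i - real l \<le> y \<bullet> i + z \<bullet> i \<and> y \<bullet> i + z \<bullet> i < z \<bullet> i + real l" if "i \<in> Basis" for i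
        using bspec[OF y(2) that] l by linarith
      then show "w \<in> qbox z (real l)"
        unfolding y(1) by (simp add: hbox_def inner_add_left inner_diff_left)
    qed
    then have "void (qbox z (real l)) \<le> void ((\<lambda>y. y + z) ` Lambda (real l / 2))"
      by (rule void_antimono)
    also have "\<dots> = void (Lambda (real l / 2))" by (rule void_translate) measurable
    also have "\<dots> \<le> ennreal (\<kappa> * (real l / 2) powr (- \<alpha>))" by (rule vL[OF l])
    also have "\<kappa> * (real l / 2) powr (- \<alpha>) = \<kappa> * 2 powr \<alpha> * real l powr (- \<alpha>)"
      by (simp add: powr_divide powr_minus field_simps)
    also have "\<dots> \<le> K * real l powr (- \<alpha>)"
      unfolding K_def by (intro mult_right_mono) auto
    finally show ?thesis by (simp add: ennreal_leI)
  qed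
  moreover have "K \<ge> 0" using \<kappa>(1) by (simp add: K_def)
  ultimately show ?thesis by blast
qed

lemma void_moment_of_high_moment:
  assumes "rho M pp \<gamma> < \<infinity>" "\<gamma> > 2" "condC Q \<alpha>" "\<alpha> \<ge> 0"
  shows "\<exists>K\<ge>0. \<forall>j\<in>ints. \<forall>z\<in>ints. \<forall>l\<ge>1.
     void_moment (ucell j) (qbox z (real l)) \<le> ennreal (K * real l powr (- (\<alpha> * (\<gamma> - 2) / \<gamma>)))"
proof -
  obtain K where K: "K \<ge> 0"
    "\<And>z l. l \<ge> 1 \<Longrightarrow> void (qbox z (real l)) \<le> ennreal (K * real l powr (- \<alpha>))"
    using condC_void[OF assms(3,4)] by blast
  obtain r where r: "r \<ge> 0" "rho M pp \<gamma> = ennreal r" using assms(1) by (cases "rho M pp \<gamma>") auto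
  have "void_moment (ucell j) (qbox z (real l)) \<le> ennreal ((K + r) * real l powr (- (\<alpha> * (\<gamma> - 2) / \<gamma>)))"
    if l: "l \<ge> 1" for j z l
  proof -
    \<comment> \<open>This threshold equalises the two error terms: both T^2 l^(-\<alpha>) and T^(2
      - \<gamma>) become l^(-\<alpha> (\<gamma> - 2) / \<gamma>).\<close>
    define T where "T = real l powr (\<alpha> / \<gamma>)"
    have T: "T > 0" using l by (simp add: T_def)
    let ?I = "\<lambda>\<omega>. indicator {0} (pcount (pp \<omega>) (qbox z (real l))) :: ennreal"
    let ?E = "\<lambda>\<omega>. epow (pcount (pp \<omega>) (ucell j)) \<gamma>"
    have "void_moment (ucell j) (qbox z (real l))
       \<le> (\<integral>\<^sup>+\<omega>. ennreal (T\<^sup>2) * ?I \<omega> + ennreal (T powr (2 - \<gamma>)) * ?E \<omega> \<partial>M)"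
      using square_le_epow[of \<gamma> T] assms(2) T
      by (intro nn_integral_mono) (auto simp: indicator_def)
    also have "\<dots> = ennreal (T\<^sup>2) * void (qbox z (real l))
        + ennreal (T powr (2 - \<gamma>)) * (\<integral>\<^sup>+\<omega>. ?E \<omega> \<partial>M)"
      by (simp add: nn_integral_add nn_integral_cmult)
    also have "\<dots> \<le> ennreal (T\<^sup>2) * ennreal (K * real l powr (- \<alpha>)) + ennreal (T powr (2 - \<gamma>)) * ennreal r"
      using K(2)[OF l] ucell_moment[of \<gamma> j] assms(2) r(2) by (intro add_mono mult_left_mono) auto
    also have "\<dots> = ennreal (T\<^sup>2 * (K * real l powr (- \<alpha>)) + T powr (2 - \<gamma>) * r)"
      using K(1) r(1) by (simp flip: ennreal_mult ennreal_plus)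
    also have "T\<^sup>2 * (K * real l powr (- \<alpha>)) = K * real l powr (- (\<alpha> * (\<gamma> - 2) / \<gamma>))"
    proof -
      have "T\<^sup>2 * real l powr (- \<alpha>) = real l powr (2 * \<alpha> / \<gamma> - \<alpha>)"
        using l unfolding T_def by (simp add: powr_power powr_add[symmetric])
      also have "2 * \<alpha> / \<gamma> - \<alpha> = - (\<alpha> * (\<gamma> - 2) / \<gamma>)" using assms(2) by (simp add: field_simps)
      finally show ?thesis by simp
    qed
    also have "T powr (2 - \<gamma>) = real l powr (- (\<alpha> * (\<gamma> - 2) / \<gamma>))"
    proof -
      have "\<alpha> / \<gamma> * (2 - \<gamma>) = - (\<alpha> * (\<gamma> - 2) / \<gamma>)" using assms(2) by (simp add: field_simps)
      then show ?thesis unfolding T_def powr_powr by simp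
    qed
    finally show ?thesis by (simp add: algebra_simps)
  qed
  moreover have "K + r \<ge> 0" using K r by simp
  ultimately show ?thesis by blast
qed

text \<open>Positive association asks for finite second moments of the test functions. Here the test
  function is already a squared count, whose square would call for a fourth moment. Hence the count
  is capped at \<open>n\<close>, and monotone convergence removes the cap.\<close>

lemma pos_assoc_void_moment:
  assumes pa: "pos_assoc Q" and z: "j \<in> ints" "z \<in> ints"
  shows "void_moment (ucell j) (qbox z (real l))
    \<le> (\<integral>\<^sup>+\<omega>. (pcount (pp \<omega>) (ucell j))\<^sup>2 \<partial>M) * void (qbox z (real l))"
  using ucell_qbox_cases[OF z, of l]
proof
  assume "ucell j \<subseteq> qbox z (real l)"
  then have "(pcount (pp \<omega>) (ucell j))\<^sup>2 * indicator {0} (pcount (pp \<omega>) (qbox z (real l))) = (0::ennreal)" for \<omega>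
    using pcount_mono[of "ucell j" "qbox z (real l)" "pp \<omega>"] by (auto simp: indicator_def)
  then have "void_moment (ucell j) (qbox z (real l)) = (\<integral>\<^sup>+\<omega>. 0 \<partial>M)"
    by (intro nn_integral_cong) blast
  then show ?thesis by simp
next
  assume disj: "ucell j \<inter> qbox z (real l) = {}"
  let ?A = "ucell j" and ?B = "qbox z (real l)"
  let ?k = "\<lambda>\<omega>. card (pp \<omega> \<inter> ?A)"
  have pc: "pcount (pp \<omega>) (hbox a b) = of_nat (card (pp \<omega> \<inter> hbox a b))" if "\<omega> \<in> space M" for \<omega> a b
    using pcount_eq_card[OF pp_loc_fin[OF that] bounded_hbox] .
  have I0: "(indicator {0} (pcount (pp \<omega>) ?B) :: ennreal) = ennreal (of_bool (card (pp \<omega> \<inter> ?B) = 0))"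
    if "\<omega> \<in> space M" for \<omega>
    using pc[OF that] by (simp add: indicator_def)
  have card_meas: "(\<lambda>\<xi>. real (card (\<xi> \<inter> hbox a b))) \<in> borel_measurable N_space" for a b :: 'a
  proof -
    have "(\<lambda>\<xi>. enn2real (pcount \<xi> (hbox a b))) \<in> borel_measurable (N_space :: 'a set measure)"
      by measurable
    then show ?thesis
      by (rule measurable_cong[THEN iffD1, rotated])
         (simp add: space_N_space pcount_eq_card[OF _ bounded_hbox] ennreal_of_nat_eq_real_of_nat)
  qed
  let ?F = "\<lambda>n \<xi>. (real (min n (card (\<xi> \<inter> ?A))))\<^sup>2"
  let ?G = "\<lambda>\<xi>. of_bool (card (\<xi> \<inter> ?B) = 0) :: real"
  have Fm: "?F n \<in> borel_measurable N_space" for n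
    using card_meas[of j "j + One"] unfolding of_nat_min by measurable
  have Gm: "?G \<in> borel_measurable N_space"
  proof -
    have "(\<lambda>\<xi>. if real (card (\<xi> \<inter> ?B)) = 0 then 1 else 0 :: real) \<in> borel_measurable (N_space :: 'a set measure)"
      using card_meas[of "z - real l *\<^sub>R One" "z + real l *\<^sub>R One"] by measurable
    then show ?thesis by (simp add: of_bool_def)
  qed
  have Fb: "?F n \<xi> \<le> (real n)\<^sup>2" for n \<xi> by (intro power_mono) auto
  interpret Q: prob_space Q by (rule prob_space_distr[OF pp_meas])
  have bnd: "integrable M (\<lambda>\<omega>. f (pp \<omega>))" "integrable Q f"
    if "f \<in> borel_measurable N_space" "\<And>\<xi>. \<bar>f \<xi>\<bar> \<le> C" for f :: "'a set \<Rightarrow> real" and C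
  proof -
    have [measurable]: "f \<in> borel_measurable N_space" by fact
    show "integrable M (\<lambda>\<omega>. f (pp \<omega>))"
      by (rule integrable_const_bound[where B=C]) (use that in auto)
    show "integrable Q f"
      by (rule Q.integrable_const_bound[where B=C]) (use that in auto)
  qed
  have trunc: "(\<integral>\<^sup>+\<omega>. ennreal (?F n (pp \<omega>)) * indicator {0} (pcount (pp \<omega>) ?B) \<partial>M)
      \<le> (\<integral>\<^sup>+\<omega>. (pcount (pp \<omega>) ?A)\<^sup>2 \<partial>M) * void ?B" for n
  proof -
    \<comment> \<open>The void indicator decreases as points are added, so its negative is the
      increasing test function. The sign turns nonnegative covariance into the upper bound that is
      wanted.\<close>
    have "(\<integral>\<xi>. ?F n \<xi> * - ?G \<xi> \<partial>Q) - (\<integral>\<xi>. ?F n \<xi> \<partial>Q) * (\<integral>\<xi>. - ?G \<xi> \<partial>Q) \<ge> 0"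
    proof -
      define f :: "nat list \<Rightarrow> real" where "f = (\<lambda>u. (real (min n (hd u)))\<^sup>2)"
      define g :: "nat list \<Rightarrow> real" where "g = (\<lambda>u. - of_bool (hd u = 0))"
      have f: "\<forall>u v. length u = length [?A] \<longrightarrow> list_all2 (\<le>) u v \<longrightarrow> f u \<le> f v"
      proof (intro allI impI)
        fix u v :: "nat list" assume "length u = length [?A]" "list_all2 (\<le>) u v"
        then show "f u \<le> f v" by (cases u; cases v) (auto simp: f_def intro!: power_mono)
      qed
      have g: "\<forall>u v. length u = length [?B] \<longrightarrow> list_all2 (\<le>) u v \<longrightarrow> g u \<le> g v"
      proof (intro allI impI)
        fix u v :: "nat list" assume "length u = length [?B]" "list_all2 (\<le>) u v"
        then show "g u \<le> g v" by (cases u; cases v) (auto simp: g_def)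
      qed
      have borel: "\<forall>A\<in>set ([?A] @ [?B]). A \<in> sets borel \<and> bounded A"
        by (auto simp: bounded_hbox)
      have disjoint: "\<forall>i<length ([?A] @ [?B]). \<forall>k<length ([?A] @ [?B]). i \<noteq> k \<longrightarrow>
          ([?A] @ [?B]) ! i \<inter> ([?A] @ [?B]) ! k = {}"
        using disj by (auto simp: less_Suc_eq)
      have f_int: "integrable Q (\<lambda>\<xi>. (f (map (\<lambda>A. card (\<xi> \<inter> A)) [?A]))\<^sup>2)"
        using borel_measurable_power[OF Fm[of n], of 2] by (intro bnd(2)[of _ "((real n)\<^sup>2)\<^sup>2"]) (auto simp: f_def intro!: power_mono)
      have g_int: "integrable Q (\<lambda>\<xi>. (g (map (\<lambda>A. card (\<xi> \<inter> A)) [?B]))\<^sup>2)"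
        using Gm by (intro bnd(2)[of _ 1]) (auto simp: g_def)
      note pa[unfolded pos_assoc_def Let_def, THEN spec[of _ "[?A]"], THEN spec[of _ "[?B]"],
          THEN spec[of _ f], THEN spec[of _ g]]
      from this[THEN mp, OF borel, THEN mp, OF disjoint, THEN mp, OF f, THEN mp, OF g,
          THEN mp, OF f_int, THEN mp, OF g_int]
      show ?thesis by (simp add: f_def g_def)
    qed
    then have "(\<integral>\<xi>. ?F n \<xi> * ?G \<xi> \<partial>Q) \<le> (\<integral>\<xi>. ?F n \<xi> \<partial>Q) * (\<integral>\<xi>. ?G \<xi> \<partial>Q)"
      by simp
    then have le: "(\<integral>\<omega>. ?F n (pp \<omega>) * ?G (pp \<omega>) \<partial>M) \<le> (\<integral>\<omega>. ?F n (pp \<omega>) \<partial>M) * (\<integral>\<omega>. ?G (pp \<omega>) \<partial>M)"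
      using Fm[of n] Gm by (simp add: integral_distr)
    have "(\<integral>\<^sup>+\<omega>. ennreal (?F n (pp \<omega>)) * indicator {0} (pcount (pp \<omega>) ?B) \<partial>M)
       = (\<integral>\<^sup>+\<omega>. ennreal (?F n (pp \<omega>) * ?G (pp \<omega>)) \<partial>M)"
      by (intro nn_integral_cong) (simp add: I0 of_bool_def)
    also have "\<dots> = ennreal (\<integral>\<omega>. ?F n (pp \<omega>) * ?G (pp \<omega>) \<partial>M)"
      using Fm[of n] Gm Fb[of n]
      by (intro nn_integral_eq_integral bnd(1)[of "\<lambda>\<xi>. ?F n \<xi> * ?G \<xi>" "(real n)\<^sup>2"]) auto
    also have "\<dots> \<le> ennreal ((\<integral>\<omega>. ?F n (pp \<omega>) \<partial>M) * (\<integral>\<omega>. ?G (pp \<omega>) \<partial>M))"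
      by (rule ennreal_leI[OF le])
    also have "\<dots> = ennreal (\<integral>\<omega>. ?F n (pp \<omega>) \<partial>M) * ennreal (\<integral>\<omega>. ?G (pp \<omega>) \<partial>M)"
      by (intro ennreal_mult integral_nonneg_AE) auto
    also have "ennreal (\<integral>\<omega>. ?F n (pp \<omega>) \<partial>M) = (\<integral>\<^sup>+\<omega>. ennreal (?F n (pp \<omega>)) \<partial>M)"
      using Fm[of n] Fb[of n] by (intro nn_integral_eq_integral[symmetric] bnd(1)[of "?F n" "(real n)\<^sup>2"]) auto
    also have "ennreal (\<integral>\<omega>. ?G (pp \<omega>) \<partial>M) = (\<integral>\<^sup>+\<omega>. ennreal (?G (pp \<omega>)) \<partial>M)"
      using Gm by (intro nn_integral_eq_integral[symmetric] bnd(1)[of "?G" 1]) auto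
    also have "\<dots> = void ?B" by (intro nn_integral_cong) (simp only: I0)
    also have "(\<integral>\<^sup>+\<omega>. ennreal (?F n (pp \<omega>)) \<partial>M) \<le> (\<integral>\<^sup>+\<omega>. (pcount (pp \<omega>) ?A)\<^sup>2 \<partial>M)"
    proof (rule nn_integral_mono)
      fix \<omega> assume "\<omega> \<in> space M"
      have "?F n (pp \<omega>) \<le> (real (?k \<omega>))\<^sup>2" by (intro power_mono) auto
      then show "ennreal (?F n (pp \<omega>)) \<le> (pcount (pp \<omega>) ?A)\<^sup>2"
        using pc[OF \<open>\<omega> \<in> space M\<close>] by (simp add: ennreal_of_nat_eq_real_of_nat ennreal_power ennreal_leI)
    qed
    finally show ?thesis by (simp add: mult_right_mono)
  qed
  have "void_moment ?A ?B
     = (\<integral>\<^sup>+\<omega>. (SUP n. ennreal (?F n (pp \<omega>)) * indicator {0} (pcount (pp \<omega>) ?B)) \<partial>M)"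
  proof (rule nn_integral_cong)
    fix \<omega> assume \<omega>: "\<omega> \<in> space M"
    have sq: "(pcount (pp \<omega>) ?A)\<^sup>2 = ennreal ((real (?k \<omega>))\<^sup>2)"
      using pc[OF \<omega>] by (simp add: ennreal_of_nat_eq_real_of_nat ennreal_power)
    show "(pcount (pp \<omega>) ?A)\<^sup>2 * indicator {0} (pcount (pp \<omega>) ?B)
       = (SUP n. ennreal (?F n (pp \<omega>)) * indicator {0} (pcount (pp \<omega>) ?B))"
      unfolding sq
      by (intro antisym SUP_upper2[of "?k \<omega>"] SUP_least mult_right_mono ennreal_leI power_mono) auto
  qed
  also have "\<dots> = (SUP n. \<integral>\<^sup>+\<omega>. ennreal (?F n (pp \<omega>)) * indicator {0} (pcount (pp \<omega>) ?B) \<partial>M)"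
  proof (rule nn_integral_monotone_convergence_SUP)
    show "incseq (\<lambda>n \<omega>. ennreal (?F n (pp \<omega>)) * indicator {0} (pcount (pp \<omega>) ?B))"
      by (auto simp: incseq_def le_fun_def intro!: mult_right_mono ennreal_leI power_mono)
    show "(\<lambda>\<omega>. ennreal (?F n (pp \<omega>)) * indicator {0} (pcount (pp \<omega>) ?B)) \<in> borel_measurable M" for n
      using measurable_compose[OF pp_meas Fm[of n]] by measurable
  qed
  also have "\<dots> \<le> (\<integral>\<^sup>+\<omega>. (pcount (pp \<omega>) ?A)\<^sup>2 \<partial>M) * void ?B"
    by (intro SUP_least trunc)
  finally show ?thesis .
qed

end

section \<open>Finite range of dependence: factorisation of void events and exponential
  decay\<close>

lemma (in prob_space) indep_var_nn_integral_mult: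
  assumes ind: "indep_var S X T Y"
    and f [measurable]: "f \<in> borel_measurable S" and g [measurable]: "g \<in> borel_measurable T"
  shows "(\<integral>\<^sup>+\<omega>. f (X \<omega>) * g (Y \<omega>) \<partial>M) = (\<integral>\<^sup>+\<omega>. f (X \<omega>) \<partial>M) * (\<integral>\<^sup>+\<omega>. g (Y \<omega>) \<partial>M)"
proof -
  have XY [measurable]: "X \<in> measurable M S" "Y \<in> measurable M T"
    and eq: "distr M S X \<Otimes>\<^sub>M distr M T Y = distr M (S \<Otimes>\<^sub>M T) (\<lambda>\<omega>. (X \<omega>, Y \<omega>))"
    using ind unfolding indep_var_distribution_eq by auto
  interpret Y: prob_space "distr M T Y" by (rule prob_space_distr) simp
  have "(\<integral>\<^sup>+\<omega>. f (X \<omega>) * g (Y \<omega>) \<partial>M)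
      = (\<integral>\<^sup>+p. f (fst p) * g (snd p) \<partial>(distr M S X \<Otimes>\<^sub>M distr M T Y))"
    unfolding eq by (subst nn_integral_distr) auto
  also have "\<dots> = (\<integral>\<^sup>+x. \<integral>\<^sup>+y. f x * g y \<partial>distr M T Y \<partial>distr M S X)"
    by (subst Y.nn_integral_fst[symmetric]) auto
  also have "\<dots> = (\<integral>\<^sup>+x. f x * (\<integral>\<^sup>+y. g y \<partial>distr M T Y) \<partial>distr M S X)"
    by (intro nn_integral_cong nn_integral_cmult) simp
  also have "\<dots> = (\<integral>\<^sup>+x. f x \<partial>distr M S X) * (\<integral>\<^sup>+y. g y \<partial>distr M T Y)"
    by (rule nn_integral_multc) simp
  finally show ?thesis by (simp add: nn_integral_distr)
qed

context stationary_pp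
begin

text \<open>\<open>setdist\<close> is 0 as soon as one set is empty, so both sets must be nonempty
  before a pointwise distance bound yields \<open>setdist A B \<ge> L\<close>.\<close>

lemma finite_range_indep:
  assumes indep: "\<And>A B. A \<in> sets borel \<Longrightarrow> B \<in> sets borel \<Longrightarrow> setdist A B \<ge> L \<Longrightarrow>
      prob_space.indep_var Q N_space (\<lambda>\<xi>. \<xi> \<inter> A) N_space (\<lambda>\<xi>. \<xi> \<inter> B)"
    and A [measurable]: "A \<in> sets borel" and B [measurable]: "B \<in> sets borel"
    and far: "A \<noteq> {}" "B \<noteq> {}" "\<And>x y. x \<in> A \<Longrightarrow> y \<in> B \<Longrightarrow> dist x y \<ge> L"
    and h [measurable]: "h \<in> borel_measurable N_space"
  shows "(\<integral>\<^sup>+\<omega>. h (pp \<omega> \<inter> A) * indicator {0} (pcount (pp \<omega>) B) \<partial>M)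
      = (\<integral>\<^sup>+\<omega>. h (pp \<omega> \<inter> A) \<partial>M) * void B"
proof -
  let ?g = "\<lambda>\<xi>. indicator {0} (pcount \<xi> B) :: ennreal"
  interpret Q: prob_space Q by (rule prob_space_distr[OF pp_meas])
  have ind: "Q.indep_var N_space (\<lambda>\<xi>. \<xi> \<inter> A) N_space (\<lambda>\<xi>. \<xi> \<inter> B)"
    by (rule indep[OF A B le_setdistI[OF far]])
  \<comment> \<open>Measurability of the restriction maps is read off from the independence
    statement, which includes it.\<close>
  then have m: "(\<lambda>\<xi>. \<xi> \<inter> A) \<in> measurable N_space N_space" "(\<lambda>\<xi>. \<xi> \<inter> B) \<in> measurable N_space N_space"
    unfolding Q.indep_var_distribution_eq by simp_all
  note [measurable] = m
  have "(\<integral>\<^sup>+\<xi>. h (\<xi> \<inter> A) * ?g (\<xi> \<inter> B) \<partial>Q) = (\<integral>\<^sup>+\<xi>. h (\<xi> \<inter> A) \<partial>Q) * (\<integral>\<^sup>+\<xi>. ?g (\<xi> \<inter> B) \<partial>Q)"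
    by (rule Q.indep_var_nn_integral_mult[OF ind h]) measurable
  moreover have "pcount (\<xi> \<inter> B) B = pcount \<xi> B" for \<xi> by (simp add: pcount_def Int_assoc)
  ultimately show ?thesis by (simp add: nn_integral_distr)
qed

text \<open>The hypothesis separates only two sets at a time. Inductively, the cell and the boxes
  treated so far are merged into one set \<open>A\<close>, still at distance at least
  \<open>L\<close> from the next box, and the partial product depends only on the points in
  \<open>A\<close>.\<close>

lemma finite_range_prod:
  assumes indep: "\<And>A B. A \<in> sets borel \<Longrightarrow> B \<in> sets borel \<Longrightarrow> setdist A B \<ge> L \<Longrightarrow>
      prob_space.indep_var Q N_space (\<lambda>\<xi>. \<xi> \<inter> A) N_space (\<lambda>\<xi>. \<xi> \<inter> B)"
    and U [measurable]: "U \<in> sets borel" and U_ne: "U \<noteq> {}"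
    and B [measurable]: "\<And>i. B i \<in> sets borel" and B_ne: "\<And>i. B i \<noteq> {}"
    and fin: "finite I"
    and farU: "\<And>i x y. i \<in> I \<Longrightarrow> x \<in> U \<Longrightarrow> y \<in> B i \<Longrightarrow> dist x y \<ge> L"
    and farB: "\<And>i k x y. i \<in> I \<Longrightarrow> k \<in> I \<Longrightarrow> i \<noteq> k \<Longrightarrow> x \<in> B i \<Longrightarrow> y \<in> B k \<Longrightarrow> dist x y \<ge> L"
  shows "(\<integral>\<^sup>+\<omega>. (pcount (pp \<omega>) U)\<^sup>2 * (\<Prod>i\<in>I. indicator {0} (pcount (pp \<omega>) (B i))) \<partial>M)
      = (\<integral>\<^sup>+\<omega>. (pcount (pp \<omega>) U)\<^sup>2 \<partial>M) * (\<Prod>i\<in>I. void (B i))"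
  using fin farU farB
proof (induction I rule: finite_induct)
  case (insert i I)
  define A where "A = U \<union> (\<Union>k\<in>I. B k)"
  define h :: "'a set \<Rightarrow> ennreal" where
    "h = (\<lambda>\<xi>. (pcount \<xi> U)\<^sup>2 * (\<Prod>k\<in>I. indicator {0} (pcount \<xi> (B k))))"
  have Am: "A \<in> sets borel" 
    unfolding A_def by (intro sets.Un U sets.finite_UN B insert.hyps(1))
  have hm: "h \<in> borel_measurable N_space" unfolding h_def by measurable
  have "\<xi> \<inter> A \<inter> U = \<xi> \<inter> U" "k \<in> I \<Longrightarrow> \<xi> \<inter> A \<inter> B k = \<xi> \<inter> B k" for \<xi> k
    unfolding A_def by auto
  then have hA: "h (\<xi> \<inter> A) = h \<xi>" for \<xi> unfolding h_def pcount_def by simp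
  have far: "dist x y \<ge> L" if "x \<in> A" "y \<in> B i" for x y
    using that insert.hyps insert.prems unfolding A_def by blast
  have "(\<integral>\<^sup>+\<omega>. (pcount (pp \<omega>) U)\<^sup>2 * (\<Prod>k\<in>insert i I. indicator {0} (pcount (pp \<omega>) (B k))) \<partial>M)
    = (\<integral>\<^sup>+\<omega>. h (pp \<omega> \<inter> A) * indicator {0} (pcount (pp \<omega>) (B i)) \<partial>M)"
    unfolding hA unfolding h_def using insert.hyps by (simp add: mult_ac)
  also have "\<dots> = (\<integral>\<^sup>+\<omega>. h (pp \<omega> \<inter> A) \<partial>M) * void (B i)"
    using U_ne by (intro finite_range_indep[OF indep Am B _ B_ne far hm]) (auto simp: A_def)
  also have "(\<integral>\<^sup>+\<omega>. h (pp \<omega> \<inter> A) \<partial>M) = (\<integral>\<^sup>+\<omega>. (pcount (pp \<omega>) U)\<^sup>2 \<partial>M) * (\<Prod>k\<in>I. void (B k))"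
    unfolding hA unfolding h_def by (intro insert.IH) (use insert.prems in blast)+
  finally show ?case using insert.hyps by (simp add: mult_ac)
qed simp

text \<open>Continuity from above: the void events of growing boxes decrease to the null event of an
  empty configuration.\<close>

lemma void_tendsto_0:
  assumes "emeasure M {\<omega> \<in> space M. pp \<omega> = {}} = 0"
  shows "(\<lambda>n. void (qbox 0 (real n))) \<longlonglongrightarrow> 0"
proof -
  let ?S = "\<lambda>n. {\<omega>\<in>space M. pcount (pp \<omega>) (qbox 0 (real n)) = 0}"
  have "(\<lambda>n. emeasure M (?S n)) \<longlonglongrightarrow> emeasure M (\<Inter>n. ?S n)"
  proof (rule Lim_emeasure_decseq)
    have "qbox 0 (real m) \<subseteq> qbox 0 (real n)" if "m \<le> n" for m n
      using that by (auto simp: hbox_def)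
    then show "decseq ?S" by (auto simp: decseq_def pcount_eq_0_iff)
  qed auto
  also have "(\<Inter>n. ?S n) = {\<omega> \<in> space M. pp \<omega> = {}}"
  proof -
    have "\<exists>n. x \<in> qbox 0 (real n)" for x :: 'a
    proof -
      obtain n :: nat where "norm x < real n" using reals_Archimedean2 by blast
      then have "- real n \<le> x \<bullet> i \<and> x \<bullet> i < real n" if "i \<in> Basis" for i
        using Basis_le_norm[OF that, of x] by linarith
      then show ?thesis by (intro exI[of _ n]) (auto simp: hbox_def)
    qed
    then show ?thesis by (auto simp: pcount_eq_0_iff)
  qed
  finally show ?thesis using assms by (simp add: void_eq_emeasure)
qed

text \<open>The small boxes are lined up along one basis direction \<open>e\<close> from the centre
  of the large box. After discarding those close to the cell, independence splits off the second
  moment of the cell and a factor at most 1/2 for each remaining box. Exponential decay makes any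
  exponent \<beta> available.\<close>

lemma finite_range_void_moment:
  assumes fr: "finite_range Q" and rho2: "rho M pp 2 < \<infinity>"
    and nonempty: "emeasure M {\<omega> \<in> space M. pp \<omega> = {}} = 0"
  shows "\<exists>K\<ge>0. \<forall>j\<in>ints. \<forall>z\<in>ints. \<forall>l\<ge>1.
     void_moment (ucell j) (qbox z (real l)) \<le> ennreal (K * real l powr (- \<beta>))"
proof -
  obtain L where L: "L > 0" and indep: "\<And>A B. A \<in> sets borel \<Longrightarrow> B \<in> sets borel \<Longrightarrow> setdist A B \<ge> L \<Longrightarrow>
      prob_space.indep_var Q N_space (\<lambda>\<xi>. \<xi> \<inter> A) N_space (\<lambda>\<xi>. \<xi> \<inter> B)"
    using fr unfolding finite_range_def by blast
  have "eventually (\<lambda>n. void (qbox 0 (real n)) < ennreal (1/2)) sequentially"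
    using void_tendsto_0[OF nonempty] by (rule order_tendstoD) (subst ennreal_less_zero_iff, simp)
  then have "eventually (\<lambda>n. void (qbox 0 (real n)) < ennreal (1/2) \<and> n \<ge> 1) sequentially"
    using eventually_ge_at_top by (rule eventually_conj)
  \<comment> \<open>Void probability at most 1/2 makes the product a power of 2;
    \<open>r \<ge> 1\<close> keeps the half-open boxes nonempty.\<close>
  then obtain r where r: "void (qbox 0 (real r)) \<le> ennreal (1/2)" "r \<ge> 1"
    unfolding eventually_sequentially by (meson less_imp_le order_refl)
  obtain R where R: "R \<ge> 0" "rho M pp 2 = ennreal R" using rho2 by (cases "rho M pp 2") auto
  obtain e :: 'a where e: "e \<in> Basis" using nonempty_Basis by blast
  \<comment> \<open>Consecutive boxes of half-side \<open>r\<close> at spacing \<open>s\<close>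
    leave a gap s - 2 r = 2 + 2 L > L. Also s / 2 = r + 1 + L bounds the offset, along
    \<open>e\<close>, between the corner of a unit cell and the centre of a box within distance L of
    it.\<close>
  define s where "s = 2 * (real r + 1 + L)"
  have s: "s > 0" using L by (simp add: s_def)
  \<comment> \<open>The 2 in the exponent absorbs two losses: one from rounding down the number of
    boxes, one from the single box that may be close to the cell.\<close>
  have main: "void_moment (ucell j) (qbox z (real l)) \<le> ennreal (R * 2 powr (2 - (real l - real r) / s))"
    for j z l
  proof -
    define N where "N = nat \<lfloor>(real l - real r) / s\<rfloor>"
    define B where "B i = qbox (z + (real i * s) *\<^sub>R e) (real r)" for i :: nat
    have Be: "z \<bullet> e + real i * s - r \<le> y \<bullet> e" "y \<bullet> e < z \<bullet> e + real i * s + r" if "y \<in> B i" for i y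
      using that e unfolding B_def hbox_def by (auto simp: inner_add_left inner_diff_left dest!: bspec[where x=e])
    have B_sub: "B i \<subseteq> qbox z (real l)" if "i < N" for i
    proof
      fix y assume y: "y \<in> B i"
      have "real i \<le> (real l - real r) / s" using that unfolding N_def by linarith
      then have i: "real i * s \<le> real l - real r" using s by (simp add: field_simps)
      have "z \<bullet> b - real l \<le> y \<bullet> b \<and> y \<bullet> b < z \<bullet> b + real l" if b: "b \<in> Basis" for b
      proof -
        have "z \<bullet> b + real i * s * (e \<bullet> b) - r \<le> y \<bullet> b" "y \<bullet> b < z \<bullet> b + real i * s * (e \<bullet> b) + r"
          using y b unfolding B_def hbox_def by (auto simp: inner_add_left inner_diff_left)
        moreover have "0 \<le> real i * s * (e \<bullet> b)" "real i * s * (e \<bullet> b) \<le> real i * s"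
          using e b s by (auto simp: inner_Basis)
        ultimately show ?thesis using i by linarith
      qed
      then show "y \<in> qbox z (real l)" by (simp add: hbox_def inner_add_left inner_diff_left)
    qed
    have far_e: "dist x y \<ge> L" if "\<bar>x \<bullet> e - y \<bullet> e\<bar> \<ge> L" for x y :: 'a
      using that Basis_le_norm[OF e, of "x - y"] by (simp add: dist_norm inner_diff_left)
    define I where "I = {i. i < N \<and> (\<forall>x\<in>ucell j. \<forall>y\<in>B i. dist x y \<ge> L)}"
    have finI: "finite I" unfolding I_def by simp
    have farB: "dist x y \<ge> L" if "i \<noteq> k" "x \<in> B i" "y \<in> B k" for i k x y
    proof (rule far_e)
      have "s \<le> \<bar>real i - real k\<bar> * s" using that(1) s by simp
      also have "\<dots> = \<bar>real i * s - real k * s\<bar>" using s by (simp flip: abs_mult_pos left_diff_distrib add: abs_mult)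
      finally show "L \<le> \<bar>x \<bullet> e - y \<bullet> e\<bar>"
        using Be[OF that(2)] Be[OF that(3)] L s_def by (smt (verit))
    qed
    \<comment> \<open>Two boxes close to the cell would both have centres less than s / 2 from
      \<open>j\<close> along \<open>e\<close>, whereas distinct centres differ by at least
      s.\<close>
    have bad: "i = k" if "i < N" "i \<notin> I" "k < N" "k \<notin> I" for i k
    proof (rule ccontr)
      assume "i \<noteq> k"
      have close: "\<bar>z \<bullet> e + real i * s - j \<bullet> e\<bar> < s / 2" if iN: "i < N" "i \<notin> I" for i
      proof -
        obtain x y where xy: "x \<in> ucell j" "y \<in> B i" "dist x y < L"
          using iN unfolding I_def by (auto simp: not_le)
        have "\<bar>x \<bullet> e - y \<bullet> e\<bar> < L" using far_e[of x y] xy(3) by linarith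
        moreover have "j \<bullet> e \<le> x \<bullet> e" "x \<bullet> e < j \<bullet> e + 1"
          using xy(1) e by (auto simp: hbox_def inner_add_left)
        moreover have "s / 2 = real r + 1 + L" by (simp add: s_def)
        ultimately show ?thesis using Be[OF xy(2)] unfolding abs_less_iff by linarith
      qed
      have "s \<le> \<bar>real i - real k\<bar> * s" using \<open>i \<noteq> k\<close> s by simp
      also have "\<dots> = \<bar>real i * s - real k * s\<bar>" using s by (simp flip: abs_mult_pos left_diff_distrib add: abs_mult)
      finally show False using close[OF that(1,2)] close[OF that(3,4)] by (smt (verit) field_sum_of_halves)
    qed
    have "N - 1 \<le> card I"
    proof -
      have "card ({..<N} - I) \<le> 1"
        using card_le_Suc0_iff_eq[of "{..<N} - I"] bad by auto
      moreover have "I \<subseteq> {..<N}" by (auto simp: I_def)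
      then have "N = card I + card ({..<N} - I)"
        using card_Diff_subset[OF finI, of "{..<N}"] card_mono[of "{..<N}" I] by simp
      ultimately show ?thesis by linarith
    qed
    have ind_le: "indicator {0} (pcount (pp \<omega>) (qbox z (real l)))
       \<le> (\<Prod>i\<in>I. indicator {0} (pcount (pp \<omega>) (B i)) :: ennreal)" for \<omega>
    proof (cases "pcount (pp \<omega>) (qbox z (real l)) = 0")
      case True
      then have "pcount (pp \<omega>) (B i) = 0" if "i \<in> I" for i
        using that pcount_mono[OF B_sub, of i "pp \<omega>"] by (auto simp: I_def)
      with True show ?thesis by simp
    qed simp
    have "void_moment (ucell j) (qbox z (real l))
       \<le> (\<integral>\<^sup>+\<omega>. (pcount (pp \<omega>) (ucell j))\<^sup>2 * (\<Prod>i\<in>I. indicator {0} (pcount (pp \<omega>) (B i))) \<partial>M)"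
      by (intro nn_integral_mono mult_left_mono ind_le) simp
    also have "\<dots> = (\<integral>\<^sup>+\<omega>. (pcount (pp \<omega>) (ucell j))\<^sup>2 \<partial>M) * (\<Prod>i\<in>I. void (B i))"
    proof (rule finite_range_prod[OF indep])
      have "j \<in> ucell j" by (simp add: hbox_def inner_add_left)
      then show "ucell j \<noteq> {}" by blast
      have "z + (real i * s) *\<^sub>R e \<in> B i" for i
        using r(2) by (simp add: B_def hbox_def inner_add_left inner_diff_left)
      then show "B i \<noteq> {}" for i by blast
    qed (auto simp: B_def finI intro: farB[unfolded B_def], auto simp: I_def B_def)
    also have "\<dots> \<le> ennreal R * (\<Prod>i\<in>I. ennreal (1/2))"
    proof (intro mult_mono prod_mono_ennreal)
      show "(\<integral>\<^sup>+\<omega>. (pcount (pp \<omega>) (ucell j))\<^sup>2 \<partial>M) \<le> ennreal R"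
        using ucell_square_moment[of j] R(2) by simp
      fix i
      have "B i = (\<lambda>y. y + (z + (real i * s) *\<^sub>R e)) ` qbox 0 (real r)"
        unfolding B_def hbox_translate by (simp add: algebra_simps)
      then show "void (B i) \<le> ennreal (1/2)" using r(1) by (simp only: void_translate hbox_borel)
    qed auto
    also have "\<dots> = ennreal (R * (1/2) ^ card I)"
    proof -
      have "(\<Prod>i\<in>I. ennreal (1/2)) = ennreal ((1/2) ^ card I)"
        unfolding prod_constant by (rule ennreal_power) simp
      then show ?thesis using R(1) by (simp only: ennreal_mult zero_le_power zero_le_divide_1_iff zero_le_numeral)
    qed
    also have "\<dots> \<le> ennreal (R * 2 powr (2 - (real l - real r) / s))"
    proof (intro ennreal_leI mult_left_mono R(1))
      have "real N - 1 \<le> real (card I)" using \<open>N - 1 \<le> card I\<close> by linarith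
      moreover have "(real l - real r) / s - 1 \<le> real N" unfolding N_def by linarith
      ultimately have "- real (card I) \<le> 2 - (real l - real r) / s" by linarith
      then have "2 powr (- real (card I)) \<le> 2 powr (2 - (real l - real r) / s)"
        by (intro powr_mono) auto
      then show "(1/2) ^ card I \<le> 2 powr (2 - (real l - real r) / s)"
        by (simp add: powr_minus powr_realpow power_one_over inverse_eq_divide)
    qed
    finally show ?thesis .
  qed
  \<comment> \<open>Convergence gives boundedness over all \<open>l\<close>, hence one constant for
    all scales, including those below \<open>r\<close>.\<close>
  have "(\<lambda>l::nat. real l powr \<beta> * 2 powr (2 - (real l - real r) / s)) \<longlonglongrightarrow> 0"
    using s by real_asymp
  then have "Bseq (\<lambda>l::nat. real l powr \<beta> * 2 powr (2 - (real l - real r) / s))"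
    by (intro convergent_imp_Bseq convergentI)
  then obtain C where C: "C > 0" "\<And>l::nat. norm (real l powr \<beta> * 2 powr (2 - (real l - real r) / s)) \<le> C"
    by (auto elim: BseqE)
  have "void_moment (ucell j) (qbox z (real l)) \<le> ennreal (R * C * real l powr (- \<beta>))"
    if "l \<ge> 1" for j z l
  proof -
    have "2 powr (2 - (real l - real r) / s) \<le> C * real l powr (- \<beta>)"
      using C(2)[of l] that by (simp add: powr_minus field_simps)
    then have "R * 2 powr (2 - (real l - real r) / s) \<le> R * (C * real l powr (- \<beta>))"
      using R(1) by (rule mult_left_mono)
    then show ?thesis using main[of j z l] by (simp add: mult.assoc order_trans[OF _ ennreal_leI])
  qed
  moreover have "R * C \<ge> 0" using R(1) C(1) by simp
  ultimately show ?thesis by blast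
qed

end

section \<open>Geometry of Delaunay neighbours\<close>

text \<open>Any point \<open>v\<close> of the common face is equally near to 0 and to x, and no
  point of the configuration is nearer. The triangle inequality through \<open>v\<close> bounds |x|
  by the diameter.\<close>

lemma DT_edge_empty_ball:
  assumes "DT_edge \<xi> 0 x"
  obtains v where "norm x \<le> 2 * norm v" "\<And>z. z \<in> \<xi> \<Longrightarrow> norm v \<le> norm (v - z)"
proof -
  obtain F where F: "F face_of Vor 0 \<xi>" "F face_of Vor x \<xi>" "aff_dim F = int DIM('a) - 1"
    and x: "0 \<in> \<xi>" "x \<in> \<xi>"
    using assms unfolding DT_edge_def by blast
  \<comment> \<open>The empty set has affine dimension -1, while d - 1 is at least 0.\<close>
  have "F \<noteq> {}" using F(3) by auto
  then obtain v where "v \<in> Vor 0 \<xi>" "v \<in> Vor x \<xi>"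
    using face_of_imp_subset[OF F(1)] face_of_imp_subset[OF F(2)] by blast
  then have v: "\<And>z. z \<in> \<xi> \<Longrightarrow> norm v \<le> norm (v - z)" "\<And>z. z \<in> \<xi> \<Longrightarrow> norm (v - x) \<le> norm (v - z)"
    by (auto simp: Vor_def)
  have "norm x \<le> norm v + norm (v - x)" using norm_triangle_ineq4[of v "v - x"] by simp
  also have "norm (v - x) \<le> norm v" using v(2)[OF x(1)] by simp
  finally show ?thesis using that v(1) by simp
qed

text \<open>The empty ball is replaced by a smaller one, tangent to it from inside at 0, of radius
  \<rho> = 2^(n + t) / 2. A box on the grid of mesh 2^n near its centre lies within 3 d 2^n of that
  centre, and this is below \<rho> exactly when 6 d < 2^t.\<close>

lemma DT_edge_empty_qbox:
  fixes x :: "'a::euclidean_space"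
  assumes edge: "DT_edge \<xi> 0 x" and t: "6 * real DIM('a) < 2 ^ t" and x: "2 ^ (n + t) \<le> norm x"
  shows "\<exists>k\<in>intbox (2 ^ t). \<xi> \<inter> qbox (2 ^ n *\<^sub>R k) (2 ^ n + 1) = {}"
proof -
  obtain v where v: "norm x \<le> 2 * norm v" "\<And>z. z \<in> \<xi> \<Longrightarrow> norm v \<le> norm (v - z)"
    by (rule DT_edge_empty_ball[OF edge]) blast
  define \<rho> :: real where "\<rho> = 2 ^ n * 2 ^ t / 2"
  have \<rho>: "0 < \<rho>" "\<rho> \<le> norm v" using x v(1) by (auto simp: \<rho>_def power_add)
  then have "v \<noteq> 0" by auto
  \<comment> \<open>The new centre lies on the segment from 0 to \<open>v\<close>, so |u - v| = |v|
    - \<rho> and the ball of radius \<rho> about \<open>u\<close> stays inside the empty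
    one.\<close>
  define u where "u = (\<rho> / norm v) *\<^sub>R v"
  have norm_u: "norm u = \<rho>" using \<rho> \<open>v \<noteq> 0\<close> by (simp add: u_def)
  have "u - v = (\<rho> / norm v - 1) *\<^sub>R v" by (simp add: u_def algebra_simps)
  then have "norm (u - v) = \<bar>\<rho> / norm v - 1\<bar> * norm v" by simp
  also have "\<dots> = (1 - \<rho> / norm v) * norm v" using \<rho> \<open>v \<noteq> 0\<close> by (simp add: abs_if field_simps)
  also have "\<dots> = norm v - \<rho>" using \<open>v \<noteq> 0\<close> by (simp add: field_simps)
  finally have uv: "norm (u - v) = norm v - \<rho>" .
  let ?w = "u /\<^sub>R 2 ^ n"
  define k :: 'a where "k = (\<Sum>i\<in>Basis. of_int \<lfloor>?w \<bullet> i\<rfloor> *\<^sub>R i)"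
  have k: "k \<in> ints" "\<And>i. i \<in> Basis \<Longrightarrow> k \<bullet> i = of_int \<lfloor>?w \<bullet> i\<rfloor>"
    using floor_vec[of ?w] unfolding k_def by auto
  have w_eq: "?w \<bullet> i = (u \<bullet> i) / 2 ^ n" for i
    by (simp only: inner_scaleR_left divide_inverse_commute)
  have "\<bar>k \<bullet> i\<bar> \<le> 2 ^ t" if i: "i \<in> Basis" for i
  proof -
    have "\<bar>u \<bullet> i\<bar> \<le> 2 ^ n * (2 ^ t / 2)" using Basis_le_norm[OF i, of u] norm_u by (simp add: \<rho>_def)
    then have "\<bar>u \<bullet> i\<bar> / 2 ^ n \<le> 2 ^ t / 2" by (simp add: field_simps)
    then have "\<bar>?w \<bullet> i\<bar> \<le> 2 ^ t / 2" unfolding w_eq by (simp add: abs_divide)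
    \<comment> \<open>Rounding down moves a coordinate by less than 1, and 2^t / 2 + 1 <= 2^t once
      2^t >= 2.\<close>
    moreover have "2 ^ t \<ge> (2 :: real)" using t DIM_positive[where 'a='a] by linarith
    ultimately show ?thesis unfolding k(2)[OF i] abs_le_iff by linarith
  qed
  then have "k \<in> intbox (2 ^ t)" using k(1) by (simp add: intbox_def)
  moreover have "\<xi> \<inter> qbox (2 ^ n *\<^sub>R k) (2 ^ n + 1) = {}"
  proof (rule ccontr)
    assume "\<xi> \<inter> qbox (2 ^ n *\<^sub>R k) (2 ^ n + 1) \<noteq> {}"
    then obtain w where w: "w \<in> \<xi>" "w \<in> qbox (2 ^ n *\<^sub>R k) (2 ^ n + 1)" by auto
    \<comment> \<open>One 2^n is the rounding error, one is the half-side, and the last covers the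
      margin 1 of the box.\<close>
    have "\<bar>(w - u) \<bullet> i\<bar> \<le> 3 * 2 ^ n" if i: "i \<in> Basis" for i
    proof -
      have "2 ^ n * (k \<bullet> i) - (2 ^ n + 1) \<le> w \<bullet> i" "w \<bullet> i < 2 ^ n * (k \<bullet> i) + (2 ^ n + 1)"
        using w(2) i by (auto simp: hbox_def inner_add_left inner_diff_left)
      moreover have "k \<bullet> i \<le> ?w \<bullet> i" "?w \<bullet> i \<le> k \<bullet> i + 1" unfolding k(2)[OF i] by linarith+
      then have "2 ^ n * (k \<bullet> i) \<le> u \<bullet> i" "u \<bullet> i \<le> 2 ^ n * (k \<bullet> i) + 2 ^ n"
        unfolding w_eq by (simp_all add: field_simps)
      moreover have "(1 :: real) \<le> 2 ^ n" by simp
      ultimately show ?thesis unfolding inner_diff_left abs_le_iff by linarith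
    qed
    then have "(\<Sum>i\<in>Basis. \<bar>(w - u) \<bullet> i\<bar>) \<le> real DIM('a) * (3 * 2 ^ n)"
      by (intro sum_bounded_above) auto
    then have "norm (w - u) \<le> real DIM('a) * (3 * 2 ^ n)"
      using norm_le_l1[of "w - u"] by linarith
    also have "\<dots> = 6 * real DIM('a) * 2 ^ n / 2" by simp
    also have "\<dots> < \<rho>" unfolding \<rho>_def using t by (simp add: mult.commute)
    finally have "norm (w - v) < norm v"
      using norm_triangle_ineq[of "w - u" "u - v"] uv by simp
    with v(2)[OF w(1)] show False by (simp add: norm_minus_commute)
  qed
  ultimately show ?thesis by blast
qed

lemma of_nat_mult_divide_less_top:
  fixes x m :: ennreal
  assumes "x < \<infinity>" "0 < m"
  shows "of_nat n * x / m < \<infinity>"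
  using assms by (simp add: divide_ennreal_def ennreal_mult_eq_top_iff less_top[symmetric])

section \<open>Dyadic summation under the Palm distribution\<close>

context stationary_pp
begin

lemma Palm_Lambda_finite:
  assumes rho2: "rho M pp 2 < \<infinity>" and m: "0 < intensity M pp"
  shows "(\<integral>\<^sup>+\<omega>. pcount (pp \<omega>) (Lambda (real R)) \<partial>P0) < \<infinity>"
proof -
  \<comment> \<open>The empty set is always void, so a plain count becomes a case of
    \<open>Palm_count_bound\<close>.\<close>
  have "(\<integral>\<^sup>+\<omega>. pcount (pp \<omega>) (Lambda (real R)) \<partial>P0)
      = (\<integral>\<^sup>+\<omega>. pcount (pp \<omega>) (Lambda (real R)) * indicator {0} (pcount (pp \<omega>) {}) \<partial>P0)"
    by (simp add: pcount_def)
  also have "\<dots> \<le> of_nat (2 * 3 ^ DIM('a) * (2 * R + 3) ^ DIM('a)) * rho M pp 2 / intensity M pp"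
    using ucell_square_moment by (intro Palm_count_bound) (auto simp: pcount_def)
  also have "\<dots> < \<infinity>"
    using rho2 m by (rule of_nat_mult_divide_less_top)
  finally show ?thesis .
qed

text \<open>Shell n contributes 2^(n \<zeta>) from the weight, 2^(n d) from the number of cells and
  2^(-n \<beta>) from the void moment. These make up q^n, and \<open>A\<close> collects everything
  independent of n.\<close>

lemma Palm_dyadic_sum_finite:
  assumes K: "K \<ge> 0" and key: "\<And>j z l. j \<in> ints \<Longrightarrow> z \<in> ints \<Longrightarrow> l \<ge> 1 \<Longrightarrow>
     void_moment (ucell j) (qbox z (real l)) \<le> ennreal (K * real l powr (- \<beta>))"
    and \<beta>: "\<beta> > real DIM('a) + \<zeta>" and C: "C \<ge> 0" and m: "0 < intensity M pp"
  shows "(\<Sum>n. ennreal (C * (2 ^ (n + t + 1)) powr \<zeta>) * (\<Sum>k\<in>intbox (2 ^ t).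
      \<integral>\<^sup>+\<omega>. pcount (pp \<omega>) (Lambda (2 ^ (n + t + 1)))
        * indicator {0} (pcount (pp \<omega>) (qbox (2 ^ n *\<^sub>R k) (2 ^ n + 1))) \<partial>P0)) < \<infinity>"
proof -
  define q where "q = 2 powr (real DIM('a) + \<zeta> - \<beta>)"
  have q: "0 \<le> q" "q < 1" using \<beta> by (auto simp: q_def powr_less_one)
  define A where "A = real (card (intbox (2 ^ t) :: 'a set)) * (C * 2 powr ((t + 1) * \<zeta>))
      * (2 * 3 ^ DIM('a) * (7 * 2 ^ t) ^ DIM('a) * K)"
  have A: "A \<ge> 0" using K C by (simp add: A_def)
  have term_le: "ennreal (C * (2 ^ (n + t + 1)) powr \<zeta>) * (\<Sum>k\<in>intbox (2 ^ t).
      \<integral>\<^sup>+\<omega>. pcount (pp \<omega>) (Lambda (2 ^ (n + t + 1)))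
        * indicator {0} (pcount (pp \<omega>) (qbox (2 ^ n *\<^sub>R k) (2 ^ n + 1))) \<partial>P0)
     \<le> ennreal (A * q ^ n) / intensity M pp" for n
  proof -
    let ?R = "2 ^ (n + t + 1) :: nat"
    have one: "(\<integral>\<^sup>+\<omega>. pcount (pp \<omega>) (Lambda (2 ^ (n + t + 1)))
        * indicator {0} (pcount (pp \<omega>) (qbox (2 ^ n *\<^sub>R k) (2 ^ n + 1))) \<partial>P0)
      \<le> ennreal (2 * 3 ^ DIM('a) * (7 * 2 ^ (n + t)) ^ DIM('a) * (K * (2 ^ n) powr (- \<beta>))) / intensity M pp"
      if k: "k \<in> intbox (2 ^ t)" for k
    proof -
      have z: "2 ^ n *\<^sub>R k \<in> ints"
        using k by (auto simp: intbox_def ints_def)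
      \<comment> \<open>The margin is spent here: half-side 2^n + 1 under \<open>P0\<close> becomes
        2^n under \<open>M\<close>, where \<open>key\<close> applies with l = 2^n.\<close>
      have "(\<integral>\<^sup>+\<omega>. pcount (pp \<omega>) (Lambda (real ?R))
          * indicator {0} (pcount (pp \<omega>) (qbox (2 ^ n *\<^sub>R k) (2 ^ n + 1))) \<partial>P0)
        \<le> of_nat (2 * 3 ^ DIM('a) * (2 * ?R + 3) ^ DIM('a)) * ennreal (K * real (2 ^ n) powr (- \<beta>)) / intensity M pp"
        using key[OF _ z, of _ "2 ^ n"]
        by (intro Palm_count_bound[where V' = "qbox (2 ^ n *\<^sub>R k) (2 ^ n)"] unit_cube_translate_qbox) auto
      also have "of_nat (2 * 3 ^ DIM('a) * (2 * ?R + 3) ^ DIM('a)) * ennreal (K * real (2 ^ n) powr (- \<beta>))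
        = ennreal (real (2 * 3 ^ DIM('a) * (2 * ?R + 3) ^ DIM('a)) * (K * (2 ^ n) powr (- \<beta>)))"
        unfolding ennreal_of_nat_eq_real_of_nat using K by (subst ennreal_mult[symmetric]) auto
      also have "\<dots> \<le> ennreal (2 * 3 ^ DIM('a) * (7 * 2 ^ (n + t)) ^ DIM('a) * (K * (2 ^ n) powr (- \<beta>)))"
      proof -
        \<comment> \<open>Since 2 R + 3 = 4 * 2^(n + t) + 3, the constant 7 absorbs the additive
          3.\<close>
        have "(1 :: real) \<le> 2 ^ (n + t)" by simp
        then have "real (2 * ?R + 3) \<le> 7 * 2 ^ (n + t)" by simp
        then have "real (2 * ?R + 3) ^ DIM('a) \<le> (7 * 2 ^ (n + t)) ^ DIM('a)"
          by (intro power_mono) auto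
        then have "2 * 3 ^ DIM('a) * real (2 * ?R + 3) ^ DIM('a) \<le> 2 * 3 ^ DIM('a) * (7 * 2 ^ (n + t)) ^ DIM('a)"
          by (intro mult_left_mono) auto
        then show ?thesis
          using K by (intro ennreal_leI mult_right_mono) simp_all
      qed
      finally show ?thesis by (simp add: divide_right_mono_ennreal)
    qed
    have "ennreal (C * (2 ^ (n + t + 1)) powr \<zeta>) * (\<Sum>k\<in>intbox (2 ^ t).
      \<integral>\<^sup>+\<omega>. pcount (pp \<omega>) (Lambda (2 ^ (n + t + 1)))
        * indicator {0} (pcount (pp \<omega>) (qbox (2 ^ n *\<^sub>R k) (2 ^ n + 1))) \<partial>P0)
      \<le> ennreal (C * (2 ^ (n + t + 1)) powr \<zeta>) * (\<Sum>k\<in>(intbox (2 ^ t) :: 'a set).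
        ennreal (2 * 3 ^ DIM('a) * (7 * 2 ^ (n + t)) ^ DIM('a) * (K * (2 ^ n) powr (- \<beta>))) / intensity M pp)"
      by (intro mult_left_mono sum_mono one) auto
    also have "\<dots> = ennreal (C * (2 ^ (n + t + 1)) powr \<zeta> * (real (card (intbox (2 ^ t) :: 'a set)) *
        (2 * 3 ^ DIM('a) * (7 * 2 ^ (n + t)) ^ DIM('a) * (K * (2 ^ n) powr (- \<beta>))))) / intensity M pp"
      using K C by (simp add: divide_ennreal_def ennreal_mult mult.assoc ennreal_of_nat_eq_real_of_nat)
    also have "C * (2 ^ (n + t + 1)) powr \<zeta> * (real (card (intbox (2 ^ t) :: 'a set)) *
        (2 * 3 ^ DIM('a) * (7 * 2 ^ (n + t)) ^ DIM('a) * (K * (2 ^ n) powr (- \<beta>)))) = A * q ^ n"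
    proof -
      have p2: "(2 ^ i) powr a = 2 powr (real i * a)" for i :: nat and a :: real
        by (simp add: powr_powr powr_realpow[symmetric])
      have 1: "(2 ^ (n + t + 1)) powr \<zeta> = 2 powr ((t + 1) * \<zeta>) * 2 powr (n * \<zeta>)"
        unfolding p2 by (simp add: powr_add[symmetric] algebra_simps)
      have "(2 ^ n) ^ DIM('a) = 2 powr (n * DIM('a))"
        by (simp add: power_mult[symmetric] powr_realpow[symmetric] powr_powr)
      then have 2: "(7 * 2 ^ (n + t)) ^ DIM('a) = (7 * 2 ^ t) ^ DIM('a) * 2 powr (n * DIM('a))"
        by (simp add: power_mult_distrib power_add)
      have 3: "(2 ^ n) powr (- \<beta>) = 2 powr (- (n * \<beta>))"
        unfolding p2 by simp
      have 4: "q ^ n = 2 powr (n * \<zeta>) * 2 powr (n * DIM('a)) * 2 powr (- (n * \<beta>))"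
        by (simp add: q_def powr_power powr_add[symmetric] algebra_simps)
      show ?thesis unfolding A_def 1 2 3 4 by (simp add: mult_ac)
    qed
    finally show ?thesis .
  qed
  have "(\<Sum>n. ennreal (A * q ^ n)) = ennreal (\<Sum>n. A * q ^ n)"
    using q A by (intro suminf_ennreal2) (auto intro!: summable_mult summable_geometric)
  then have "(\<Sum>n. ennreal (A * q ^ n) / intensity M pp) < \<infinity>"
    using m by (simp add: divide_ennreal_def ennreal_suminf_multc ennreal_mult_eq_top_iff less_top[symmetric])
  then show ?thesis by (rule le_less_trans[OF suminf_le[OF term_le summableI summableI]])
qed

end

text \<open>A measurable stand-in for the Delaunay neighbourhood of the origin, so that the measurability
  of the edge relation itself is never needed.\<close>

definition near_or_void :: "nat \<Rightarrow> ('a::euclidean_space set \<times> 'a) set" where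
  "near_or_void t = {(\<xi>, x). \<xi> \<in> loc_fin \<and> (norm x < 2 ^ t \<or>
     (\<exists>n. 2 ^ (n + t) \<le> norm x \<and> norm x < 2 ^ (n + t + 1) \<and>
       (\<exists>k\<in>intbox (2 ^ t). pcount \<xi> (qbox (2 ^ n *\<^sub>R k) (2 ^ n + 1)) = 0)))}"

lemma near_or_void_measurable:
  "near_or_void t \<in> sets (N_space \<Otimes>\<^sub>M (borel :: 'a::euclidean_space measure))"
proof -
  have cnt [measurable]: "(\<lambda>p. pcount (fst p) A) \<in> borel_measurable (N_space \<Otimes>\<^sub>M (borel :: 'a measure))"
    if "A \<in> sets borel" for A
    using measurable_compose[OF measurable_fst measurable_pcount[OF that]] .
  have [measurable]: "Measurable.pred (N_space \<Otimes>\<^sub>M (borel :: 'a measure))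
      (\<lambda>p. \<exists>k\<in>intbox (2 ^ t). pcount (fst p) (qbox (2 ^ n *\<^sub>R k) (2 ^ n + 1)) = 0)" for n
    by (rule pred_intros_finite[OF finite_intbox]) measurable
  have "{p \<in> space (N_space \<Otimes>\<^sub>M (borel :: 'a measure)). norm (snd p) < 2 ^ t \<or>
     (\<exists>n. 2 ^ (n + t) \<le> norm (snd p) \<and> norm (snd p) < 2 ^ (n + t + 1) \<and>
       (\<exists>k\<in>intbox (2 ^ t). pcount (fst p) (qbox (2 ^ n *\<^sub>R k) (2 ^ n + 1)) = 0))}
     \<in> sets (N_space \<Otimes>\<^sub>M borel)"
    by measurable
  also have "{p \<in> space (N_space \<Otimes>\<^sub>M (borel :: 'a measure)). norm (snd p) < 2 ^ t \<or>
     (\<exists>n. 2 ^ (n + t) \<le> norm (snd p) \<and> norm (snd p) < 2 ^ (n + t + 1) \<and>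
       (\<exists>k\<in>intbox (2 ^ t). pcount (fst p) (qbox (2 ^ n *\<^sub>R k) (2 ^ n + 1)) = 0))} = near_or_void t"
    unfolding near_or_void_def by (auto simp: space_pair_measure space_N_space)
  finally show ?thesis .
qed

lemma DT_edge_near_or_void:
  fixes x :: "'a::euclidean_space"
  assumes edge: "DT_edge \<xi> 0 x" and t: "6 * real DIM('a) < 2 ^ t" and lf: "\<xi> \<in> loc_fin"
  shows "(\<xi>, x) \<in> near_or_void t"
proof (cases "norm x < 2 ^ t")
  case True
  then show ?thesis using lf by (simp add: near_or_void_def)
next
  case False
  obtain N where N: "norm x < 2 ^ N" using real_arch_pow[of 2 "norm x"] by auto
  \<comment> \<open>Minimality of the exponent locates the dyadic shell containing x; x not being
    close to 0 forces \<open>t < m\<close>.\<close>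
  define m where "m = (LEAST N. norm x < 2 ^ N)"
  have m: "norm x < 2 ^ m" unfolding m_def by (rule LeastI[of _ N]) (rule N)
  have "t < m"
  proof (rule ccontr)
    assume "\<not> t < m"
    then have "(2 :: real) ^ m \<le> 2 ^ t" by (intro power_increasing) auto
    then show False using m False by linarith
  qed
  then obtain n where n: "m = n + t + 1" by (metis Suc_eq_plus1 add.commute less_natE add_Suc_right)
  have "\<not> norm x < 2 ^ (n + t)"
    using not_less_Least[of "n + t" "\<lambda>N. norm x < 2 ^ N"] n unfolding m_def[symmetric] by simp
  then have x: "2 ^ (n + t) \<le> norm x" by simp
  then show ?thesis
    using DT_edge_empty_qbox[OF edge t x] m n lf unfolding near_or_void_def pcount_eq_0_iff by auto
qed

text \<open>A union bound over shells and candidate boxes. Each shell is enlarged to the cube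
  \<open>Lambda\<close> around it, so that only counts in boxes and void indicators remain, which is
  the form \<open>Palm_count_bound\<close> accepts.\<close>

lemma near_or_void_sum_le:
  fixes f :: "'a::euclidean_space \<Rightarrow> ennreal"
  assumes near: "\<And>x. norm x < 2 ^ t \<Longrightarrow> f x \<le> B"
    and far: "\<And>n x. 2 ^ (n + t) \<le> norm x \<Longrightarrow> norm x < 2 ^ (n + t + 1) \<Longrightarrow> f x \<le> a n"
  shows "(\<integral>\<^sup>+x. indicator (near_or_void t) (\<xi>, x) * f x \<partial>count_space \<xi>)
    \<le> B * pcount \<xi> (Lambda (2 ^ t)) + (\<Sum>n. a n * (\<Sum>k\<in>intbox (2 ^ t).
        pcount \<xi> (Lambda (2 ^ (n + t + 1))) * indicator {0} (pcount \<xi> (qbox (2 ^ n *\<^sub>R k) (2 ^ n + 1)))))"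
proof -
  let ?I = "\<lambda>n k. indicator {0} (pcount \<xi> (qbox (2 ^ n *\<^sub>R k) (2 ^ n + 1))) :: ennreal"
  let ?F = "\<lambda>n x. a n * (\<Sum>k\<in>intbox (2 ^ t). indicator (Lambda (2 ^ (n + t + 1))) x * ?I n k)"
  have in_Lambda: "x \<in> Lambda r" if "norm x \<le> r" for x :: 'a and r
    using that Basis_le_norm[of _ x] by (force simp: mem_Lambda)
  have pt: "indicator (near_or_void t) (\<xi>, x) * f x
      \<le> B * indicator (Lambda (2 ^ t)) x + (\<Sum>n. ?F n x)" for x
  proof (cases "(\<xi>, x) \<in> near_or_void t")
    case True
    then consider "norm x < 2 ^ t" | n k where "2 ^ (n + t) \<le> norm x" "norm x < 2 ^ (n + t + 1)"
      "k \<in> intbox (2 ^ t)" "pcount \<xi> (qbox (2 ^ n *\<^sub>R k) (2 ^ n + 1)) = 0"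
      unfolding near_or_void_def by auto
    then show ?thesis
    proof cases
      case 1
      then have "f x \<le> B * indicator (Lambda (2 ^ t)) x" using near in_Lambda[of x "2 ^ t"] by simp
      then show ?thesis using True by (simp add: add_increasing2)
    next
      case 2
      have "f x \<le> a n * (indicator (Lambda (2 ^ (n + t + 1))) x * ?I n k)"
        using far[OF 2(1,2)] in_Lambda[of x "2 ^ (n + t + 1)"] 2 by simp
      also have "\<dots> \<le> ?F n x"
        using 2(3) finite_intbox by (intro mult_left_mono member_le_sum) auto
      also have "\<dots> \<le> (\<Sum>n. ?F n x)"
        using sum_le_suminf[of "\<lambda>n. ?F n x" "{n}"] by (simp add: summableI)
      finally show ?thesis using True by (simp add: add_increasing)
    qed
  qed simp
  have "(\<integral>\<^sup>+x. indicator (near_or_void t) (\<xi>, x) * f x \<partial>count_space \<xi>)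
     \<le> (\<integral>\<^sup>+x. B * indicator (Lambda (2 ^ t)) x + (\<Sum>n. ?F n x) \<partial>count_space \<xi>)"
    by (intro nn_integral_mono pt)
  also have "\<dots> = B * pcount \<xi> (Lambda (2 ^ t)) + (\<Sum>n. \<integral>\<^sup>+x. ?F n x \<partial>count_space \<xi>)"
    by (simp add: nn_integral_add nn_integral_cmult nn_integral_count_indicator nn_integral_suminf)
  also have "(\<lambda>n. \<integral>\<^sup>+x. ?F n x \<partial>count_space \<xi>) = (\<lambda>n. a n * (\<Sum>k\<in>intbox (2 ^ t).
        pcount \<xi> (Lambda (2 ^ (n + t + 1))) * ?I n k))"
    by (simp add: nn_integral_cmult nn_integral_sum nn_integral_multc nn_integral_count_indicator)
  finally show ?thesis .
qed

context stationary_pp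
begin

lemma Palm_near_or_void_finite:
  fixes f :: "'a \<Rightarrow> ennreal"
  assumes rho2: "rho M pp 2 < \<infinity>" and m: "0 < intensity M pp"
    and K: "K \<ge> 0" and key: "\<And>j z l. j \<in> ints \<Longrightarrow> z \<in> ints \<Longrightarrow> l \<ge> 1 \<Longrightarrow>
     void_moment (ucell j) (qbox z (real l)) \<le> ennreal (K * real l powr (- \<beta>))"
    and \<beta>: "\<beta> > real DIM('a) + \<zeta>" and C: "C \<ge> 0"
    and near: "\<And>x. norm x < 2 ^ t \<Longrightarrow> f x \<le> ennreal B"
    and far: "\<And>n x. 2 ^ (n + t) \<le> norm x \<Longrightarrow> norm x < 2 ^ (n + t + 1) \<Longrightarrow>
      f x \<le> ennreal (C * (2 ^ (n + t + 1)) powr \<zeta>)"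
  shows "(\<integral>\<^sup>+\<omega>. (\<integral>\<^sup>+x. indicator (near_or_void t) (pp \<omega>, x) * f x \<partial>count_space (pp \<omega>)) \<partial>P0) < \<infinity>"
proof -
  let ?a = "\<lambda>n. ennreal (C * (2 ^ (n + t + 1)) powr \<zeta>)"
  let ?J = "\<lambda>n k \<omega>. pcount (pp \<omega>) (Lambda (2 ^ (n + t + 1))) *
      indicator {0} (pcount (pp \<omega>) (qbox (2 ^ n *\<^sub>R k) (2 ^ n + 1))) :: ennreal"
  have [measurable]: "pp \<in> measurable P0 N_space" by measurable
  have "(\<integral>\<^sup>+\<omega>. (\<integral>\<^sup>+x. indicator (near_or_void t) (pp \<omega>, x) * f x \<partial>count_space (pp \<omega>)) \<partial>P0)
     \<le> (\<integral>\<^sup>+\<omega>. ennreal B * pcount (pp \<omega>) (Lambda (2 ^ t))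
          + (\<Sum>n. ?a n * (\<Sum>k\<in>intbox (2 ^ t). ?J n k \<omega>)) \<partial>P0)"
    by (intro nn_integral_mono near_or_void_sum_le near far)
  also have "\<dots> = ennreal B * (\<integral>\<^sup>+\<omega>. pcount (pp \<omega>) (Lambda (2 ^ t)) \<partial>P0)
      + (\<Sum>n. ?a n * (\<Sum>k\<in>intbox (2 ^ t). \<integral>\<^sup>+\<omega>. ?J n k \<omega> \<partial>P0))"
    by (simp add: nn_integral_add nn_integral_cmult nn_integral_suminf nn_integral_sum)
  also have "\<dots> < \<infinity>"
    using Palm_Lambda_finite[OF rho2 m, of "2 ^ t"] Palm_dyadic_sum_finite[OF K key \<beta> C m, of t]
    by (simp add: ennreal_mult_less_top)
  finally show ?thesis .
qed

end

section \<open>Integrability of the weights\<close>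

context stationary_pp
begin

lemma rho_2_finite:
  assumes "rho M pp \<gamma> < \<infinity>" "\<gamma> > 2"
  shows "rho M pp 2 < \<infinity>"
proof -
  have "rho M pp 2 \<le> (\<integral>\<^sup>+\<omega>. 1 + epow (pcount (pp \<omega>) unit_cube) \<gamma> \<partial>M)"
    unfolding rho_def epow_2 using square_le_epow[of \<gamma> 1] assms(2) by (intro nn_integral_mono) simp
  also have "\<dots> = 1 + rho M pp \<gamma>"
    unfolding rho_def by (simp add: nn_integral_add emeasure_space_1)
  finally show ?thesis using assms(1) by (auto simp: less_top[symmetric] top_unique)
qed

text \<open>The three alternatives meet in a single decay estimate with exponent above d + \<zeta>;
  the final argument uses only this estimate and the finite second moment.\<close>

lemma void_moment_bound:
  assumes nonempty: "emeasure M {\<omega> \<in> space M. pp \<omega> = {}} = 0" and "\<zeta> \<ge> 0"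
    and H: "(\<exists>\<gamma>>2. rho M pp \<gamma> < \<infinity> \<and>
              (\<exists>\<alpha>. \<alpha> > \<gamma> / (\<gamma> - 2) * (real DIM('a) + \<zeta>) \<and> condC Q \<alpha>))
          \<or> (rho M pp 2 < \<infinity> \<and> finite_range Q)
          \<or> (rho M pp 2 < \<infinity> \<and> pos_assoc Q \<and>
              (\<exists>\<alpha>. \<alpha> > real DIM('a) + \<zeta> \<and> condC Q \<alpha>))"
  shows "rho M pp 2 < \<infinity>"
    and "\<exists>K \<beta>. K \<ge> 0 \<and> \<beta> > real DIM('a) + \<zeta> \<and> (\<forall>j\<in>ints. \<forall>z\<in>ints. \<forall>l\<ge>1.
      void_moment (ucell j) (qbox z (real l)) \<le> ennreal (K * real l powr (- \<beta>)))"
proof -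
  show rho2: "rho M pp 2 < \<infinity>" using H rho_2_finite by auto
  from H show "\<exists>K \<beta>. K \<ge> 0 \<and> \<beta> > real DIM('a) + \<zeta> \<and> (\<forall>j\<in>ints. \<forall>z\<in>ints. \<forall>l\<ge>1.
      void_moment (ucell j) (qbox z (real l)) \<le> ennreal (K * real l powr (- \<beta>)))"
  proof (elim disjE exE conjE)
    fix \<gamma> \<alpha> assume a: "\<gamma> > 2" "rho M pp \<gamma> < \<infinity>" "\<alpha> > \<gamma> / (\<gamma> - 2) * (real DIM('a) + \<zeta>)" "condC Q \<alpha>"
    \<comment> \<open>This is where the factor \<gamma> / (\<gamma> - 2) in (H1) comes from: it
      undoes the loss of exponent in the truncation.\<close>
    have "\<alpha> * (\<gamma> - 2) / \<gamma> > real DIM('a) + \<zeta>" using a(1,3) by (simp add: field_simps)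
    moreover have "0 \<le> \<gamma> / (\<gamma> - 2) * (real DIM('a) + \<zeta>)"
      using a(1) \<open>\<zeta> \<ge> 0\<close> by (intro mult_nonneg_nonneg) auto
    then have "\<alpha> \<ge> 0" using a(3) by linarith
    ultimately show ?thesis using void_moment_of_high_moment[OF a(2,1,4)] by blast
  next
    assume "finite_range Q"
    from finite_range_void_moment[OF this rho2 nonempty, of "real DIM('a) + \<zeta> + 1"]
    obtain K where "K \<ge> 0" "\<forall>j\<in>ints. \<forall>z\<in>ints. \<forall>l\<ge>1.
      void_moment (ucell j) (qbox z (real l)) \<le> ennreal (K * real l powr (- (real DIM('a) + \<zeta> + 1)))" by blast
    then show ?thesis by (intro exI[of _ K] exI[of _ "real DIM('a) + \<zeta> + 1"]) auto
  next
    fix \<alpha> assume a: "pos_assoc Q" "\<alpha> > real DIM('a) + \<zeta>" "condC Q \<alpha>"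
    have "\<alpha> \<ge> 0" using a(2) \<open>\<zeta> \<ge> 0\<close> by (simp add: add_nonneg_nonneg order_less_le_trans less_imp_le)
    then obtain K where K: "K \<ge> 0" "\<And>z l. l \<ge> 1 \<Longrightarrow> void (qbox z (real l)) \<le> ennreal (K * real l powr (- \<alpha>))"
      using condC_void[OF a(3)] by blast
    obtain R where R: "R \<ge> 0" "rho M pp 2 = ennreal R" using rho2 by (cases "rho M pp 2") auto
    have "void_moment (ucell j) (qbox z (real l)) \<le> ennreal (R * K * real l powr (- \<alpha>))"
      if "j \<in> ints" "z \<in> ints" "l \<ge> 1" for j z l
    proof -
      have "void_moment (ucell j) (qbox z (real l))
          \<le> (\<integral>\<^sup>+\<omega>. (pcount (pp \<omega>) (ucell j))\<^sup>2 \<partial>M) * void (qbox z (real l))"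
        by (rule pos_assoc_void_moment[OF a(1) that(1,2)])
      also have "\<dots> \<le> ennreal R * ennreal (K * real l powr (- \<alpha>))"
        using ucell_square_moment[of j] R(2) K(2)[OF that(3), of z] by (intro mult_mono) auto
      finally show ?thesis using R(1) K(1) by (simp add: ennreal_mult mult.assoc)
    qed
    then show ?thesis using a(2) R(1) K(1) by (intro exI[of _ "R * K"] exI[of _ \<alpha>]) auto
  qed
qed

end

text \<open>In \<open>cond_exp\<close> the conditional expectation appears as a function
  \<open>g\<close> of configuration and point jointly, characterised by test functions
  \<open>H\<close> summed over the points. This makes sense of conditioning simultaneously for all
  the random points x.\<close>

theorem theorem4p9:
  fixes M :: "'w measure"
    and \<theta> :: "'a::euclidean_space \<Rightarrow> 'w \<Rightarrow> 'w"
    and pp :: "'w \<Rightarrow> 'a set"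
    and c :: "'w \<Rightarrow> 'a \<Rightarrow> 'a \<Rightarrow> real"
    and \<phi> :: "real \<Rightarrow> real"
    and C0 \<zeta> :: real
  assumes prob: "prob_space M"
    and act_meas: "(\<lambda>(x, \<omega>). \<theta> x \<omega>) \<in> measurable (borel \<Otimes>\<^sub>M M) M"
    and act_zero: "\<And>\<omega>. \<omega> \<in> space M \<Longrightarrow> \<theta> 0 \<omega> = \<omega>"
    and act_add: "\<And>x y \<omega>. \<omega> \<in> space M \<Longrightarrow> \<theta> (x + y) \<omega> = \<theta> x (\<theta> y \<omega>)"
    and pp_meas: "pp \<in> measurable M N_space"
    and c_meas: "(\<lambda>(\<omega>, x, y). c \<omega> x y) \<in> borel_measurable (M \<Otimes>\<^sub>M borel \<Otimes>\<^sub>M borel)"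
    and c_nonneg: "\<And>\<omega> x y. \<omega> \<in> space M \<Longrightarrow> c \<omega> x y \<ge> 0"
    and c_sym: "\<And>\<omega> x y. \<omega> \<in> space M \<Longrightarrow> c \<omega> x y = c \<omega> y x"
    and c_diag: "\<And>\<omega> x. \<omega> \<in> space M \<Longrightarrow> c \<omega> x x = 0"
    and c_DT: "\<And>\<omega> x y. \<omega> \<in> space M \<Longrightarrow> \<not> DT_edge (pp \<omega>) x y \<Longrightarrow> c \<omega> x y = 0"
    and A1_inv: "\<And>x. distr M M (\<theta> x) = M"
    and A1_nonempty: "emeasure M {\<omega> \<in> space M. pp \<omega> = {}} = 0"
    and A2: "0 < intensity M pp" "intensity M pp < \<infinity>"
    and A3: "\<exists>\<Omega>s \<in> sets M. emeasure M (space M - \<Omega>s) = 0 \<and>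
              (\<forall>x. \<theta> x -` \<Omega>s \<inter> space M = \<Omega>s) \<and>
              (\<forall>\<omega> \<in> \<Omega>s. \<forall>x. pp (\<theta> x \<omega>) = (\<lambda>y. y - x) ` pp \<omega> \<and>
                 (\<forall>y z. DT_edge (pp \<omega>) y z \<longrightarrow> c (\<theta> x \<omega>) (y - x) (z - x) = c \<omega> y z))"
    and phi_meas: "\<phi> \<in> borel_measurable (restrict_space borel {0..})"
    and phi_nonneg: "\<And>r. r \<ge> 0 \<Longrightarrow> \<phi> r \<ge> 0"
    and phi_locbdd: "\<And>R. \<exists>B. \<forall>r \<in> {0..R}. \<phi> r \<le> B"
    and C0_pos: "C0 > 0" and zeta_nonneg: "\<zeta> \<ge> 0"
    and phi_bound: "\<And>r. r \<ge> 1 \<Longrightarrow> \<phi> r \<le> C0 * r powr (-2 + \<zeta>)"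
    and cond_exp: "\<exists>g :: 'a set \<times> 'a \<Rightarrow> ennreal.
        g \<in> borel_measurable (N_space \<Otimes>\<^sub>M borel) \<and>
        (\<forall>H \<in> borel_measurable (N_space \<Otimes>\<^sub>M borel).
           (\<integral>\<^sup>+ \<omega>. (\<integral>\<^sup>+ x. H (pp \<omega>, x) * ennreal (c \<omega> 0 x) \<partial>count_space (pp \<omega>)) \<partial>Palm M \<theta> pp)
         = (\<integral>\<^sup>+ \<omega>. (\<integral>\<^sup>+ x. H (pp \<omega>, x) * g (pp \<omega>, x) \<partial>count_space (pp \<omega>)) \<partial>Palm M \<theta> pp)) \<and>
        (AE \<omega> in Palm M \<theta> pp. \<forall>x. DT_edge (pp \<omega>) 0 x \<longrightarrow> g (pp \<omega>, x) \<le> ennreal (\<phi> (norm x)))"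
    and H: "(\<exists>\<gamma>>2. rho M pp \<gamma> < \<infinity> \<and>
              (\<exists>\<alpha>. \<alpha> > \<gamma> / (\<gamma> - 2) * (real DIM('a) + \<zeta>) \<and> condC (distr M N_space pp) \<alpha>))
          \<or> (rho M pp 2 < \<infinity> \<and> finite_range (distr M N_space pp))
          \<or> (rho M pp 2 < \<infinity> \<and> pos_assoc (distr M N_space pp) \<and>
              (\<exists>\<alpha>. \<alpha> > real DIM('a) + \<zeta> \<and> condC (distr M N_space pp) \<alpha>))"
  shows "(\<forall>k \<in> {0, 2}. lam c pp k \<in> borel_measurable (Palm M \<theta> pp) \<and>
             (\<integral>\<^sup>+ \<omega>. lam c pp k \<omega> \<partial>Palm M \<theta> pp) < \<infinity>)"
proof
  from A3 obtain \<Omega>s where \<Omega>s: "\<Omega>s \<in> sets M" "emeasure M (space M - \<Omega>s) = 0"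
    "\<And>\<omega> x. \<omega> \<in> \<Omega>s \<Longrightarrow> pp (\<theta> x \<omega>) = (\<lambda>y. y - x) ` pp \<omega>"
  proof (elim bexE conjE)
    fix S assume S_full: "S \<in> sets M" "emeasure M (space M - S) = 0"
      and S: "\<forall>\<omega>\<in>S. \<forall>x. pp (\<theta> x \<omega>) = (\<lambda>y. y - x) ` pp \<omega> \<and>
        (\<forall>y z. DT_edge (pp \<omega>) y z \<longrightarrow> c (\<theta> x \<omega>) (y - x) (z - x) = c \<omega> y z)"
    have "pp (\<theta> x \<omega>) = (\<lambda>y. y - x) ` pp \<omega>" if "\<omega> \<in> S" for \<omega> x
      using bspec[OF S that] by simp
    with S_full show thesis by (rule that)
  qed
  have "AE \<omega> in M. \<omega> \<in> \<Omega>s"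
    using \<Omega>s(1,2) by (intro AE_I[where N = "space M - \<Omega>s"]) auto
  then have cov: "AE \<omega> in M. \<forall>x. pp (\<theta> x \<omega>) = (\<lambda>y. y - x) ` pp \<omega>"
    by eventually_elim (simp add: \<Omega>s(3))
  interpret prob_space M by fact
  interpret stationary_pp M \<theta> pp
    by unfold_locales (use act_meas pp_meas A1_inv cov in auto)
  obtain t :: nat where t: "6 * real DIM('a) < 2 ^ t"
    using real_arch_pow[of 2 "6 * real DIM('a)"] by auto
  obtain K \<beta> where K: "K \<ge> 0" "\<beta> > real DIM('a) + \<zeta>"
    "\<And>j z l. j \<in> ints \<Longrightarrow> z \<in> ints \<Longrightarrow> l \<ge> 1 \<Longrightarrow>
      void_moment (ucell j) (qbox z (real l)) \<le> ennreal (K * real l powr (- \<beta>))"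
    using void_moment_bound(2)[OF A1_nonempty zeta_nonneg H] by blast
  obtain B where B: "\<forall>r\<in>{0..2 ^ t}. \<phi> r \<le> B"
    using phi_locbdd[of "2 ^ t"] by blast
  obtain g :: "'a set \<times> 'a \<Rightarrow> ennreal" where g [measurable]: "g \<in> borel_measurable (N_space \<Otimes>\<^sub>M borel)"
    and g_eq: "\<And>H. H \<in> borel_measurable (N_space \<Otimes>\<^sub>M borel) \<Longrightarrow>
           (\<integral>\<^sup>+ \<omega>. (\<integral>\<^sup>+ x. H (pp \<omega>, x) * ennreal (c \<omega> 0 x) \<partial>count_space (pp \<omega>)) \<partial>P0)
         = (\<integral>\<^sup>+ \<omega>. (\<integral>\<^sup>+ x. H (pp \<omega>, x) * g (pp \<omega>, x) \<partial>count_space (pp \<omega>)) \<partial>P0)"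
    and g_le: "AE \<omega> in P0. \<forall>x. DT_edge (pp \<omega>) 0 x \<longrightarrow> g (pp \<omega>, x) \<le> ennreal (\<phi> (norm x))"
    using cond_exp by blast
  have phi_norm [measurable]: "(\<lambda>x::'a. \<phi> (norm x)) \<in> borel_measurable borel"
    by (rule measurable_compose[OF _ phi_meas]) (auto intro!: measurable_restrict_space2)
  fix k :: nat assume k: "k \<in> {0, 2}"
  have lam_eq: "lam c pp k \<omega> = (\<integral>\<^sup>+x. ennreal (c \<omega> 0 x * norm x ^ k) \<partial>count_space (pp \<omega>))"
    if \<omega>: "\<omega> \<in> space M" for \<omega>
  proof -
    have "{x. DT_edge (pp \<omega>) 0 x} = pp \<omega> \<inter> {x. DT_edge (pp \<omega>) 0 x}"
      by (auto simp: DT_edge_def)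
    then have "lam c pp k \<omega> = (\<integral>\<^sup>+x. ennreal (c \<omega> 0 x * norm x ^ k)
        * indicator {x. DT_edge (pp \<omega>) 0 x} x \<partial>count_space (pp \<omega>))"
      unfolding lam_def by (metis nn_integral_count_space_Int)
    also have "\<dots> = (\<integral>\<^sup>+x. ennreal (c \<omega> 0 x * norm x ^ k) \<partial>count_space (pp \<omega>))"
      using c_DT[OF \<omega>] by (intro nn_integral_cong) (auto simp: indicator_def)
    finally show ?thesis .
  qed
  show "lam c pp k \<in> borel_measurable P0 \<and> (\<integral>\<^sup>+ \<omega>. lam c pp k \<omega> \<partial>P0) < \<infinity>"
  proof
    have "(\<lambda>p. c (fst p) 0 (snd p)) \<in> borel_measurable (M \<Otimes>\<^sub>M borel)"
      using measurable_compose[of "\<lambda>p. (fst p, 0, snd p)" "M \<Otimes>\<^sub>M borel", OF _ c_meas] by simp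
    then have "(\<lambda>p. ennreal (c (fst p) 0 (snd p) * norm (snd p) ^ k)) \<in> borel_measurable (M \<Otimes>\<^sub>M borel)"
      by measurable
    from measurable_count_sum[OF pp_meas this] have "lam c pp k \<in> borel_measurable M"
      by (simp add: lam_eq cong: measurable_cong)
    then show "lam c pp k \<in> borel_measurable P0" by measurable
  next
    \<comment> \<open>Almost surely \<open>?D\<close> contains every edge at 0, so inserting its
      indicator leaves the sum with \<open>c\<close> unchanged. After \<open>c\<close> is exchanged
      for \<open>g\<close>, pairs that are not edges may contribute too. There \<open>g\<close> has
      no a priori bound, so the inequality with \<phi> is built into \<open>?D\<close>.\<close>
    let ?D = "near_or_void t \<inter> {p \<in> space (N_space \<Otimes>\<^sub>M borel). g p \<le> ennreal (\<phi> (norm (snd p)))}"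
    let ?H = "\<lambda>p. indicator ?D p * ennreal (norm (snd p) ^ k)"
    have D: "?D \<in> sets (N_space \<Otimes>\<^sub>M borel)"
      by (intro sets.Int near_or_void_measurable) measurable
    have "(\<integral>\<^sup>+ \<omega>. lam c pp k \<omega> \<partial>P0)
        = (\<integral>\<^sup>+ \<omega>. (\<integral>\<^sup>+ x. ?H (pp \<omega>, x) * ennreal (c \<omega> 0 x) \<partial>count_space (pp \<omega>)) \<partial>P0)"
    proof (rule nn_integral_cong_AE)
      have "AE \<omega> in P0. \<omega> \<in> space M" using AE_space[of P0] by simp
      with g_le show "AE \<omega> in P0. lam c pp k \<omega>
          = (\<integral>\<^sup>+ x. ?H (pp \<omega>, x) * ennreal (c \<omega> 0 x) \<partial>count_space (pp \<omega>))"
      proof eventually_elim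
        case (elim \<omega>)
        have "ennreal (c \<omega> 0 x * norm x ^ k) = ?H (pp \<omega>, x) * ennreal (c \<omega> 0 x)" for x
        proof (cases "DT_edge (pp \<omega>) 0 x")
          case True
          then have "(pp \<omega>, x) \<in> ?D"
            using DT_edge_near_or_void[OF True t pp_loc_fin[OF elim(2)]] elim(1) pp_loc_fin[OF elim(2)]
            by (simp add: space_pair_measure space_N_space)
          then show ?thesis using c_nonneg[OF elim(2)] by (simp add: ennreal_mult mult.commute)
        qed (simp add: c_DT[OF elim(2)])
        then show ?case by (simp add: lam_eq[OF elim(2)])
      qed
    qed
    also have "\<dots> = (\<integral>\<^sup>+ \<omega>. (\<integral>\<^sup>+ x. ?H (pp \<omega>, x) * g (pp \<omega>, x) \<partial>count_space (pp \<omega>)) \<partial>P0)"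
      by (intro g_eq borel_measurable_times_ennreal borel_measurable_indicator D) measurable
    also have "\<dots> \<le> (\<integral>\<^sup>+\<omega>. (\<integral>\<^sup>+x. indicator (near_or_void t) (pp \<omega>, x)
        * ennreal (norm x ^ k * \<phi> (norm x)) \<partial>count_space (pp \<omega>)) \<partial>P0)"
    proof (intro nn_integral_mono)
      fix \<omega> x
      show "?H (pp \<omega>, x) * g (pp \<omega>, x)
          \<le> indicator (near_or_void t) (pp \<omega>, x) * ennreal (norm x ^ k * \<phi> (norm x))"
      proof (cases "(pp \<omega>, x) \<in> ?D")
        case True
        then have "g (pp \<omega>, x) \<le> ennreal (\<phi> (norm x))" "(pp \<omega>, x) \<in> near_or_void t" by simp_all
        then show ?thesis
          using True phi_nonneg[of "norm x"] by (simp add: ennreal_mult mult_left_mono)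
      qed simp
    qed
    also have "\<dots> < \<infinity>"
    proof (rule Palm_near_or_void_finite[OF _ A2(1) K(1,3,2)])
      show "rho M pp 2 < \<infinity>" by (rule void_moment_bound(1)[OF A1_nonempty zeta_nonneg H])
      show "C0 \<ge> 0" using C0_pos by simp
      show "ennreal (norm x ^ k * \<phi> (norm x)) \<le> ennreal ((2 ^ t) ^ k * B)" if "norm x < 2 ^ t" for x :: 'a
        using that bspec[OF B, of "norm x"] phi_nonneg[of "norm x"]
        by (intro ennreal_leI mult_mono power_mono) auto
      show "ennreal (norm x ^ k * \<phi> (norm x)) \<le> ennreal (C0 * (2 ^ (n + t + 1)) powr \<zeta>)"
        if x: "2 ^ (n + t) \<le> norm x" "norm x < 2 ^ (n + t + 1)" for n and x :: 'a
      proof (rule ennreal_leI)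
        have "(1 :: real) \<le> 2 ^ (n + t)" by simp
        then have x1: "norm x \<ge> 1" using x(1) by linarith
        \<comment> \<open>Outside the unit ball the weight for k = 0 is dominated by that for k = 2,
          so one estimate serves both.\<close>
        have "norm x ^ k \<le> norm x powr 2" using k x1 by auto
        then have "norm x ^ k * \<phi> (norm x) \<le> norm x powr 2 * (C0 * norm x powr (-2 + \<zeta>))"
          using phi_bound[OF x1] phi_nonneg[of "norm x"] by (intro mult_mono) auto
        also have "\<dots> = C0 * norm x powr \<zeta>"
        proof -
          have "norm x powr 2 * norm x powr (-2 + \<zeta>) = norm x powr \<zeta>"
            by (subst powr_add[symmetric]) simp
          then show ?thesis by (metis mult.left_commute)
        qed
        also have "\<dots> \<le> C0 * (2 ^ (n + t + 1)) powr \<zeta>"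
          using x(2) zeta_nonneg C0_pos by (intro mult_left_mono powr_mono2) auto
        finally show "norm x ^ k * \<phi> (norm x) \<le> C0 * (2 ^ (n + t + 1)) powr \<zeta>" .
      qed
    qed
    finally show "(\<integral>\<^sup>+ \<omega>. lam c pp k \<omega> \<partial>P0) < \<infinity>" .
  qed
qed

end
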